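(* For every $\epsilon>0$, every planar $k$-terminal network $G$ with $\gamma(G)=1$ admits a minor cut sparsifier of quality $1+\epsilon$ and size $\tilde{O}\big((k/\epsilon)^2\big)$ (where $\tilde O$ hides factors polylogarithmic in $k/\epsilon$).
   Context: A $k$-terminal network $G=(V,E,T,c)$ is a finite connected undirected graph with edge weights $c:E\to\mathbb{R}_{>0}$ and a set $T\subseteq V$ of $k$ terminals. For $S\subset T$, $S\neq\emptyset,T$, $\mathrm{mincut}_G(S)$ is the minimum total weight of edges with exactly one endpoint in $W$, over $W\subseteq V$ with $W\cap T\in\{S,T\setminus S\}$. A network $H=(V_H,E_H,T,c_H)$ with the same terminals is a cut sparsifier of $G$ of quality $q$ and size $s$ if $|V_H|\le s$ and $\mathrm{mincut}_G(S)\le\mathrm{mincut}_H(S)\le q\,\mathrm{mincut}_G(S)$ for all such $S$; it is a minor cut sparsifier if moreover $H$ is a minor of $G$ (terminals remaining distinct vertices). For a planar network with a fixed embedding, $\gamma(G)$ is the minimum number of faces whose boundaries together contain all terminals.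
   Formalization: Proved for 0 < ε < 1 instead of every ε > 0: for large ε (well above √k) the size bound Õ((k/ε)²) drops below k, which is impossible since all k terminals must remain; bounded ε ≥ 1 follows from ε = 1/2 with a larger constant. *)

theory Defs
  imports Complex_Main
begin

text \<open>Simple undirected networks on vertex labels of type nat. An edge is a 2-element set.
  A network is given by (V, E, T, c): vertex set, edge set, terminal set, edge weights.\<close>

definition is_network :: "nat set \<Rightarrow> nat set set \<Rightarrow> nat set \<Rightarrow> (nat set \<Rightarrow> real) \<Rightarrow> bool" where
  "is_network V E T c \<longleftrightarrow>
     finite V \<and> V \<noteq> {} \<and>
     E \<subseteq> {{u, v} | u v. u \<in> V \<and> v \<in> V \<and> u \<noteq> v} \<and>
     (\<forall>e\<in>E. c e > 0) \<and> T \<subseteq> V \<and>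
     (\<forall>u\<in>V. \<forall>v\<in>V. (u, v) \<in> {(x, y). {x, y} \<in> E}\<^sup>*)"

text \<open>Weight of the cut defined by vertex set W: edges with exactly one endpoint in W.\<close>
definition cut_weight :: "nat set set \<Rightarrow> (nat set \<Rightarrow> real) \<Rightarrow> nat set \<Rightarrow> real" where
  "cut_weight E c W = (\<Sum>e\<in>{e\<in>E. card (e \<inter> W) = 1}. c e)"

definition mincut :: "nat set \<Rightarrow> nat set set \<Rightarrow> nat set \<Rightarrow> (nat set \<Rightarrow> real) \<Rightarrow> nat set \<Rightarrow> real" where
  "mincut V E T c S =
     Min {cut_weight E c W | W. W \<subseteq> V \<and> (W \<inter> T = S \<or> W \<inter> T = T - S)}"

text \<open>H = (VH, EH) is a minor of G = (V, E) keeping the terminals T as distinct vertices: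
  there are nonempty, pairwise disjoint branch sets B x \<subseteq> V (x \<in> VH), each inducing a connected
  subgraph of G, such that every edge of H joins two branch sets adjacent in G, and every
  terminal t lies in its own branch set B t.\<close>
definition is_terminal_minor ::
  "nat set \<Rightarrow> nat set set \<Rightarrow> nat set \<Rightarrow> nat set set \<Rightarrow> nat set \<Rightarrow> bool" where
  "is_terminal_minor VH EH V E T \<longleftrightarrow>
     (\<exists>B :: nat \<Rightarrow> nat set.
        (\<forall>x\<in>VH. B x \<noteq> {} \<and> B x \<subseteq> V) \<and>
        (\<forall>x\<in>VH. \<forall>y\<in>VH. x \<noteq> y \<longrightarrow> B x \<inter> B y = {}) \<and>
        (\<forall>x\<in>VH. \<forall>u\<in>B x. \<forall>w\<in>B x.
            (u, w) \<in> {(p, q). {p, q} \<in> E \<and> p \<in> B x \<and> q \<in> B x}\<^sup>*) \<and>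
        (\<forall>x\<in>VH. \<forall>y\<in>VH. {x, y} \<in> EH \<longrightarrow> (\<exists>u\<in>B x. \<exists>w\<in>B y. {u, w} \<in> E)) \<and>
        (\<forall>t\<in>T. t \<in> VH \<and> t \<in> B t))"

text \<open>Combinatorial embeddings (rotation systems). N v is the neighbourhood of v.
  A rotation system sigma gives, for every vertex v, a cyclic permutation sigma v of N v.\<close>
definition nbrs :: "nat set set \<Rightarrow> nat \<Rightarrow> nat set" where
  "nbrs E v = {u. {u, v} \<in> E}"

definition darts :: "nat set set \<Rightarrow> (nat \<times> nat) set" where
  "darts E = {(u, v). {u, v} \<in> E}"

definition rotation_system :: "nat set \<Rightarrow> nat set set \<Rightarrow> (nat \<Rightarrow> nat \<Rightarrow> nat) \<Rightarrow> bool" where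
  "rotation_system V E \<sigma> \<longleftrightarrow>
     (\<forall>v\<in>V. bij_betw (\<sigma> v) (nbrs E v) (nbrs E v) \<and>
        (\<forall>u\<in>nbrs E v. \<forall>w\<in>nbrs E v. \<exists>n. (\<sigma> v ^^ n) u = w))"

text \<open>Face-tracing permutation on darts and the faces (its orbits).\<close>
definition face_perm :: "(nat \<Rightarrow> nat \<Rightarrow> nat) \<Rightarrow> nat \<times> nat \<Rightarrow> nat \<times> nat" where
  "face_perm \<sigma> d = (snd d, \<sigma> (snd d) (fst d))"

definition faces :: "nat set set \<Rightarrow> (nat \<Rightarrow> nat \<Rightarrow> nat) \<Rightarrow> (nat \<times> nat) set set" where
  "faces E \<sigma> = {{(face_perm \<sigma> ^^ n) d | n. True} | d. d \<in> darts E}"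

text \<open>Vertices on the boundary of a face f.\<close>
definition face_vertices :: "(nat \<times> nat) set \<Rightarrow> nat set" where
  "face_vertices f = fst ` f"

text \<open>A planar (genus 0) embedding of a connected graph: Euler's formula V - E + F = 2
  (the edgeless one-vertex graph is trivially embedded, with one face containing its vertex).\<close>
definition planar_embedding :: "nat set \<Rightarrow> nat set set \<Rightarrow> (nat \<Rightarrow> nat \<Rightarrow> nat) \<Rightarrow> bool" where
  "planar_embedding V E \<sigma> \<longleftrightarrow> rotation_system V E \<sigma> \<and>
     (E = {} \<or> int (card V) - int (card E) + int (card (faces E \<sigma>)) = 2)"

text \<open>gamma(G) = 1 w.r.t. the embedding sigma: T is nonempty and a single face contains
  all terminals on its boundary.\<close>
definition gamma_one :: "nat set \<Rightarrow> nat set set \<Rightarrow> (nat \<Rightarrow> nat \<Rightarrow> nat) \<Rightarrow> nat set \<Rightarrow> bool" where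
  "gamma_one V E \<sigma> T \<longleftrightarrow> T \<noteq> {} \<and>
     (if E = {} then T \<subseteq> V else (\<exists>f\<in>faces E \<sigma>. T \<subseteq> face_vertices f))"

end

theory Submission
  imports Defs
begin

text \<open>Duality turns cuts into joins. Split the dual vertex of the terminal face into \<open>k\<close> gaps, one between
  each two consecutive terminals. By Euler's formula an edge set is a cut iff its only odd dual vertices are gaps,
  and these gaps are the places where the cut changes sides on the terminals. Hence \<open>mincut\<close> is a minimum-weight
  join of a set of gaps, and such a join decomposes into shortest paths between gaps.

  So it suffices to find few edges \<open>F\<close> that preserve the dual distances between gaps up to \<open>1 + \<epsilon>\<close>, and to contract
  the components of \<open>G - F\<close>. A shortest path between gaps \<open>a\<close> and \<open>b\<close> meets every path from a gap between them to
  one outside. Taking dyadic pairs \<open>a, b\<close> as separators and, for each gap and each separator of its scale,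
  shortest paths to \<open>O(1/\<epsilon>)\<close> portals on it gives \<open>N = O(k log k / \<epsilon>)\<close> shortest paths.
  After a generic perturbation shortest paths are unique, so two of them share a contiguous stretch; adding a path to
  \<open>n\<close> earlier ones creates \<open>O(n + k)\<close> new independent cycles or gap-to-gap joins, so that \<open>G - F\<close> has
  \<open>O(N (N + k))\<close> components.\<close>

section \<open>Boundaries of edge sets modulo 2\<close>

text \<open>Paths are not sequences of edges here. An edge set serves as a path from x to y when its
  odd vertices are x and y; concatenation is symmetric difference, and minimality under positive
  weights removes closed parts. The same GF(2) language covers cycles, joins and cuts, with
  dimensions appearing as exponents of 2 in cardinalities. Two countings carry the proof. Parity
  along face walks gives one half of the duality, that cuts have their boundary in the gaps; the
  converse holds because Euler's formula leaves no room for further such sets. The vertices of the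
  minor are counted by cuts: m components of G - F give \<open>2 ^ (m - 1)\<close> cuts inside F,
  each a relative cycle of the dual modulo the gaps. Splitting the terminal face gives a meaning to
  the dual distance between two places on that face, which are one vertex of the ordinary dual. The
  price is that connectivity of the split dual needs an argument of its own. The lower bound on
  minimum cuts is free for every contraction that keeps the terminals apart; only the upper bound
  needs distances.\<close>

notation sym_diff (infixl "\<triangle>" 65)

lemma odd_card_sym_diff:
  assumes "finite A" "finite B"
  shows "odd (card (A \<triangle> B)) \<longleftrightarrow> (odd (card A) \<noteq> odd (card B))"
proof -
  have "card A = card (A - B) + card (A \<inter> B)"
    using assms by (metis Diff_disjoint Int_Diff_disjoint Un_Diff_Int card_Un_disjoint finite_Diff finite_Int Int_commute)
  moreover have "card B = card (B - A) + card (A \<inter> B)"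
    using assms by (metis Int_Diff_disjoint Un_Diff_Int card_Un_disjoint finite_Diff finite_Int Int_commute)
  moreover have "card (A \<triangle> B) = card (A - B) + card (B - A)"
    using assms by (intro card_Un_disjoint) auto
  ultimately show ?thesis by auto
qed

lemma sum_sym_diff:
  fixes w :: "'e \<Rightarrow> real"
  assumes "finite A" "finite B"
  shows "sum w (A \<triangle> B) = sum w A + sum w B - 2 * sum w (A \<inter> B)"
proof -
  have "sum w A = sum w (A - B) + sum w (A \<inter> B)"
    using assms by (metis add.commute sum.Int_Diff)
  moreover have "sum w B = sum w (B - A) + sum w (A \<inter> B)"
    using assms by (metis add.commute sum.Int_Diff Int_commute)
  moreover have "sum w (A \<triangle> B) = sum w (A - B) + sum w (B - A)"
    using assms by (intro sum.union_disjoint) auto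
  ultimately show ?thesis by auto
qed

locale multigraph =
  fixes l r :: "'e \<Rightarrow> 'b"
begin

text \<open>The GF(2) boundary. Comparing the two equations drops loops, which do occur in the dual:
  the two sides of a bridge may belong to the same dual vertex.\<close>

definition bd :: "'e set \<Rightarrow> 'b set" where
  "bd D = {x. odd (card {e \<in> D. (l e = x) \<noteq> (r e = x)})}"

definition verts :: "'e set \<Rightarrow> 'b set" where
  "verts D = l ` D \<union> r ` D"

lemma bd_empty [simp]: "bd {} = {}"
  by (simp add: bd_def)

lemma bd_sym_diff:
  assumes "finite A" "finite B"
  shows "bd (A \<triangle> B) = bd A \<triangle> bd B"
proof -
  have "odd (card {e \<in> A \<triangle> B. P e}) \<longleftrightarrow> (odd (card {e \<in> A. P e}) \<noteq> odd (card {e \<in> B. P e}))" for P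
  proof -
    have "{e \<in> A \<triangle> B. P e} = {e \<in> A. P e} \<triangle> {e \<in> B. P e}" by auto
    then show ?thesis using odd_card_sym_diff[of "{e \<in> A. P e}" "{e \<in> B. P e}"] assms by simp
  qed
  then show ?thesis unfolding bd_def by auto
qed

lemma bd_singleton: "bd {e} = {l e} \<triangle> {r e}"
proof -
  have "{e' \<in> {e}. (l e' = x) \<noteq> (r e' = x)} = (if (l e = x) \<noteq> (r e = x) then {e} else {})" for x by auto
  then show ?thesis unfolding bd_def by auto
qed

lemma bd_subset_verts: "bd D \<subseteq> verts D"
proof
  fix x assume "x \<in> bd D"
  then have "{e \<in> D. (l e = x) \<noteq> (r e = x)} \<noteq> {}"
    unfolding bd_def by (metis (mono_tags, lifting) card.empty even_zero mem_Collect_eq)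
  then show "x \<in> verts D" unfolding verts_def by auto
qed

lemma verts_mono: "A \<subseteq> B \<Longrightarrow> verts A \<subseteq> verts B"
  unfolding verts_def by auto

lemma verts_Un: "verts (A \<union> B) = verts A \<union> verts B"
  unfolding verts_def by auto

lemma finite_verts: "finite D \<Longrightarrow> finite (verts D)"
  unfolding verts_def by auto

lemma finite_bd: "finite D \<Longrightarrow> finite (bd D)"
  using bd_subset_verts finite_verts finite_subset by blast

lemma bd_remove:
  assumes "finite D" "e \<in> D"
  shows "bd (D - {e}) = bd D \<triangle> ({l e} \<triangle> {r e})"
proof -
  have "D - {e} = D \<triangle> {e}" using assms by auto
  then show ?thesis using bd_sym_diff[of D "{e}"] bd_singleton assms by simp
qed

lemma bd_insert:
  assumes "finite D" "e \<notin> D"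
  shows "bd (insert e D) = bd D \<triangle> ({l e} \<triangle> {r e})"
proof -
  have "insert e D = D \<triangle> {e}" using assms by auto
  then show ?thesis using bd_sym_diff[of D "{e}"] bd_singleton assms by simp
qed

lemma bd_Diff:
  assumes "finite D" "A \<subseteq> D"
  shows "bd (D - A) = bd D \<triangle> bd A"
proof -
  have "D - A = D \<triangle> A" using assms by auto
  then show ?thesis using bd_sym_diff[of D A] assms by (metis finite_subset)
qed

lemma even_card_bd: "finite D \<Longrightarrow> even (card (bd D))"
proof (induction D rule: finite_induct)
  case (insert e D)
  have "even (card ({l e} \<triangle> {r e}))" by (cases "l e = r e") (auto simp: Diff_triv insert_Diff_if)
  then show ?case using odd_card_sym_diff[of "bd D" "{l e} \<triangle> {r e}"] bd_insert[of D e] insert finite_bd by auto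
qed simp

text \<open>An Euler walk from \<open>u\<close>: deleting an edge at \<open>u\<close> makes
  \<open>u\<close> even and toggles the parity of its other end \<open>u'\<close>. Either
  \<open>u'\<close> was odd before and the walk stops there, or it is odd now and the walk goes on
  from \<open>u'\<close> among fewer edges.\<close>

lemma join_partner:
  assumes "finite D" "u \<in> bd D"
  shows "\<exists>v\<in>bd D. v \<noteq> u \<and> (\<exists>A\<subseteq>D. bd A = {u, v})"
  using assms
proof (induction "card D" arbitrary: D u rule: less_induct)
  case less
  have "{e \<in> D. (l e = u) \<noteq> (r e = u)} \<noteq> {}"
    using less.prems unfolding bd_def by (metis (mono_tags, lifting) card.empty even_zero mem_Collect_eq)
  then obtain e where e: "e \<in> D" "(l e = u) \<noteq> (r e = u)" by auto
  define u' where "u' = (if l e = u then r e else l e)"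
  have ends: "{l e} \<triangle> {r e} = {u, u'}" "u' \<noteq> u" using e unfolding u'_def by (auto split: if_splits)
  show ?case
  proof (cases "u' \<in> bd D")
    case True
    moreover have "bd {e} = {u, u'}" using ends bd_singleton[of e] by simp
    ultimately show ?thesis using ends(2) e(1) by blast
  next
    case False
    have bdD: "bd (D - {e}) = bd D \<triangle> {u, u'}" using bd_remove[OF less.prems(1) e(1)] ends(1) by metis
    have "card (D - {e}) < card D" using e less.prems by (meson card_Diff1_less)
    moreover have "u' \<in> bd (D - {e})" using bdD False by auto
    ultimately obtain v A where v: "v \<in> bd (D - {e})" "v \<noteq> u'" "A \<subseteq> D - {e}" "bd A = {u', v}"
      using less.hyps[of "D - {e}" u'] less.prems by blast
    have "finite A" "e \<notin> A" using v less.prems finite_subset[of A D] by auto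
    then have "bd (insert e A) = {u', v} \<triangle> {u, u'}" using bd_insert[of A e] ends(1) v(4) by metis
    moreover have "u \<notin> bd (D - {e})" unfolding bdD using less.prems(2) by blast
    then have "v \<noteq> u" using v(1) by blast
    moreover have "v \<in> bd D" using v(1,2) \<open>v \<noteq> u\<close> unfolding bdD by blast
    ultimately have "bd (insert e A) = {u, v}" "v \<in> bd D" "v \<noteq> u" using v(2) ends(2) by (simp_all, blast)
    moreover have "insert e A \<subseteq> D" using v(3) e(1) by blast
    ultimately show ?thesis by blast
  qed
qed

text \<open>Stands in for a path from \<open>x\<close> to \<open>y\<close>, up to closed parts. The
  symmetric difference covers \<open>x = y\<close> as well, where it asks for an empty boundary, so
  that concatenation holds without side conditions on the ends.\<close>

definition joins :: "'e set \<Rightarrow> 'b \<Rightarrow> 'b \<Rightarrow> bool" where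
  "joins D x y \<longleftrightarrow> bd D = {x} \<triangle> {y}"

lemma joins_self [simp]: "joins {} x x"
  unfolding joins_def by simp

lemma joins_empty_iff: "bd D = {} \<Longrightarrow> joins D x y \<longleftrightarrow> x = y"
  unfolding joins_def by auto

lemma joins_sym: "joins D x y \<Longrightarrow> joins D y x"
  unfolding joins_def by (simp add: Un_commute)

lemma joins_edge: "joins {e} (l e) (r e)"
  unfolding joins_def by (rule bd_singleton)

lemma joins_in_bd: "joins D x y \<Longrightarrow> x \<noteq> y \<Longrightarrow> x \<in> bd D"
  unfolding joins_def by simp

lemma joins_iff: "x \<noteq> y \<Longrightarrow> joins D x y \<longleftrightarrow> bd D = {x, y}"
proof -
  assume "x \<noteq> y"
  then have "{x} \<triangle> {y} = {x, y}" by blast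
  then show ?thesis unfolding joins_def by simp
qed

lemma joins_trans:
  assumes "finite A" "finite B" "joins A x y" "joins B y z"
  shows "joins (A \<triangle> B) x z"
proof -
  have "bd (A \<triangle> B) = ({x} \<triangle> {y}) \<triangle> ({y} \<triangle> {z})"
    using assms unfolding joins_def by (simp only: bd_sym_diff)
  also have "\<dots> = {x} \<triangle> {z}" by blast
  finally show ?thesis unfolding joins_def .
qed

lemma joins_Diff:
  assumes "finite D" "A \<subseteq> D" "joins D x y" "joins A x z"
  shows "joins (D - A) z y"
proof -
  have "bd (D - A) = ({x} \<triangle> {y}) \<triangle> ({x} \<triangle> {z})"
    using assms unfolding joins_def by (simp only: bd_Diff)
  also have "\<dots> = {z} \<triangle> {y}" by blast
  finally show ?thesis unfolding joins_def .
qed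

text \<open>Reduces cuts to pairs of gaps. \<open>join_partner\<close> splits off a join of two odd
  vertices, which \<open>pair\<close> replaces by one inside \<open>F\<close>; the rest has two odd
  vertices fewer. Recombining by symmetric difference cancels common edges and so costs at most the
  sum.\<close>

lemma join_stretch:
  fixes w :: "'e \<Rightarrow> real"
  assumes "finite D" "D \<subseteq> E" "bd D \<subseteq> J" "finite F" "\<And>e. e \<in> F \<Longrightarrow> 0 \<le> w e"
    and pair: "\<And>u v A. \<lbrakk>u \<in> J; v \<in> J; u \<noteq> v; A \<subseteq> E; finite A; bd A = {u, v}\<rbrakk> \<Longrightarrow>
      \<exists>A'\<subseteq>F. bd A' = {u, v} \<and> sum w A' \<le> q * sum w A"
    and "0 \<le> q" "\<And>e. e \<in> E \<Longrightarrow> 0 \<le> w e"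
  shows "\<exists>D'\<subseteq>F. bd D' = bd D \<and> sum w D' \<le> q * sum w D"
  using assms(1,2,3)
proof (induction "card (bd D)" arbitrary: D rule: less_induct)
  case less
  show ?case
  proof (cases "bd D = {}")
    case True
    have "0 \<le> sum w D" using assms(8) less.prems by (intro sum_nonneg) auto
    then show ?thesis using True assms(7) by (intro exI[of _ "{}"]) auto
  next
    case False
    then obtain u where u: "u \<in> bd D" by auto
    obtain v A where v: "v \<in> bd D" "v \<noteq> u" "A \<subseteq> D" "bd A = {u, v}"
      using join_partner[OF less.prems(1) u] by blast
    have finA: "finite A" using v less.prems finite_subset[of A D] by auto
    obtain A' where A': "A' \<subseteq> F" "bd A' = {u, v}" "sum w A' \<le> q * sum w A"
      using pair[OF _ _ v(2)[symmetric] subset_trans[OF v(3) less.prems(2)] finA v(4)] u v(1) less.prems(3)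
      by blast
    have "bd (D - A) = bd D \<triangle> {u, v}" using bd_Diff[of D A] less.prems(1) v(3,4) by metis
    also have "\<dots> = bd D - {u, v}" using v(1) u by blast
    finally have bdr: "bd (D - A) = bd D - {u, v}" .
    have "card (bd (D - A)) < card (bd D)"
      unfolding bdr using u finite_bd[OF less.prems(1)] by (intro psubset_card_mono) auto
    moreover have "finite (D - A)" "D - A \<subseteq> E" "bd (D - A) \<subseteq> J"
      using less.prems unfolding bdr by auto
    ultimately obtain B where B: "B \<subseteq> F" "bd B = bd (D - A)" "sum w B \<le> q * sum w (D - A)"
      using less.hyps[of "D - A"] by blast
    have fin: "finite A'" "finite B" using A'(1) B(1) assms(4) by (simp_all add: finite_subset)
    have "bd (A' \<triangle> B) = {u, v} \<triangle> (bd D - {u, v})" by (simp only: bd_sym_diff[OF fin] A'(2) B(2) bdr)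
    also have "\<dots> = bd D" using u v(1) by blast
    finally have "bd (A' \<triangle> B) = bd D" .
    moreover have "0 \<le> sum w (A' \<inter> B)" using A'(1) assms(5) by (intro sum_nonneg) blast
    then have "sum w (A' \<triangle> B) \<le> sum w A' + sum w B" using sum_sym_diff[OF fin, of w] by linarith
    moreover have "sum w D = sum w (D - A) + sum w A" using v(3) less.prems(1)
      by (intro sum.subset_diff)
    then have "sum w A' + sum w B \<le> q * sum w D" using A'(3) B(3) by (simp add: algebra_simps)
    moreover have "A' \<triangle> B \<subseteq> F" using A'(1) B(1) by blast
    ultimately show ?thesis by (meson order_trans)
  qed
qed

end

section \<open>Unique shortest paths\<close>

text \<open>By \<open>winj\<close> distinct edge sets differ in weight, so minimum-weight joins are
  unique and equalities of length become equalities of edge sets. \<open>joined\<close> is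
  connectivity in terms of joins.\<close>

locale geodesic_graph = multigraph l r for l r :: "'e \<Rightarrow> 'b" +
  fixes E :: "'e set" and X :: "'b set" and w :: "'e \<Rightarrow> real"
  assumes fin: "finite E"
    and ends: "\<And>e. e \<in> E \<Longrightarrow> l e \<in> X \<and> r e \<in> X"
    and wpos: "\<And>e. e \<in> E \<Longrightarrow> 0 < w e"
    and winj: "inj_on (sum w) (Pow E)"
    and joined: "\<And>x y. x \<in> X \<Longrightarrow> y \<in> X \<Longrightarrow> \<exists>D\<subseteq>E. joins D x y"
begin

text \<open>For ends in \<open>X\<close> this is well determined in spite of \<open>SOME\<close>,
  because of \<open>winj\<close>; \<open>path_acyclic\<close> shows that no closed part survives the
  minimisation.\<close>

definition path :: "'b \<Rightarrow> 'b \<Rightarrow> 'e set" where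
  "path x y = (SOME D. is_arg_min (sum w) (\<lambda>D. D \<subseteq> E \<and> joins D x y) D)"

definition gd :: "'b \<Rightarrow> 'b \<Rightarrow> real" where
  "gd x y = sum w (path x y)"

text \<open>The metric interval between \<open>x\<close> and \<open>y\<close>. \<open>seg_eq\<close>
  identifies it with the vertices on the path; \<open>x\<close> is listed apart there because the
  path from \<open>x\<close> to itself has no edges.\<close>

definition seg :: "'b \<Rightarrow> 'b \<Rightarrow> 'b set" where
  "seg x y = {z \<in> X. gd x z + gd z y = gd x y}"

lemma fin_sub: "D \<subseteq> E \<Longrightarrow> finite D"
  using fin finite_subset by auto

lemma sum_nn: "D \<subseteq> E \<Longrightarrow> 0 \<le> sum w D"
  using wpos by (intro sum_nonneg) (auto simp: less_imp_le subset_iff)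

lemma sum_le_0: "D \<subseteq> E \<Longrightarrow> sum w D \<le> 0 \<Longrightarrow> D = {}"
  using wpos fin_sub sum_pos[of D w] by (metis linorder_not_le subset_iff)

lemma sum_mono: "A \<subseteq> B \<Longrightarrow> B \<subseteq> E \<Longrightarrow> sum w A \<le> sum w B"
  using wpos fin_sub by (intro sum_mono2) (auto simp: less_imp_le subset_iff)

lemma sum_sym_diff_le: "A \<subseteq> E \<Longrightarrow> B \<subseteq> E \<Longrightarrow> sum w (A \<triangle> B) \<le> sum w A + sum w B"
  using sum_sym_diff[of A B w] sum_nn[of "A \<inter> B"] fin_sub by auto

lemma path_arg_min:
  assumes "x \<in> X" "y \<in> X"
  shows "is_arg_min (sum w) (\<lambda>D. D \<subseteq> E \<and> joins D x y) (path x y)"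
proof -
  have "\<exists>D. is_arg_min (sum w) (\<lambda>D. D \<in> {D. D \<subseteq> E \<and> joins D x y}) D"
    using joined[OF assms] fin by (intro ex_is_arg_min_if_finite) auto
  then show ?thesis unfolding path_def mem_Collect_eq by (rule someI_ex)
qed

lemma
  assumes "x \<in> X" "y \<in> X"
  shows path_subset: "path x y \<subseteq> E"
    and joins_path: "joins (path x y) x y"
    and gd_le: "\<And>D. D \<subseteq> E \<Longrightarrow> joins D x y \<Longrightarrow> gd x y \<le> sum w D"
  using path_arg_min[OF assms] unfolding is_arg_min_linorder gd_def by auto

lemma path_eqI:
  assumes "x \<in> X" "y \<in> X" "D \<subseteq> E" "joins D x y" "sum w D \<le> gd x y"
  shows "D = path x y"
proof -
  have "sum w D = sum w (path x y)"
    using gd_le[OF assms(1,2,3,4)] assms(5) by (simp add: gd_def)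
  then show ?thesis using inj_onD[OF winj, of D "path x y"] path_subset[OF assms(1,2)] assms(3) by blast
qed

lemma path_sym:
  assumes "x \<in> X" "y \<in> X"
  shows "path x y = path y x"
proof (rule path_eqI[OF assms(2,1)])
  show "sum w (path x y) \<le> gd y x"
    using gd_le[OF assms path_subset[OF assms(2,1)] joins_sym[OF joins_path[OF assms(2,1)]]]
    by (simp add: gd_def)
qed (use path_subset joins_sym[OF joins_path] assms in blast)+

lemma gd_sym: "x \<in> X \<Longrightarrow> y \<in> X \<Longrightarrow> gd x y = gd y x"
  unfolding gd_def by (simp add: path_sym[of x y])

lemma gd_nonneg: "x \<in> X \<Longrightarrow> y \<in> X \<Longrightarrow> 0 \<le> gd x y"
  unfolding gd_def by (intro sum_nn path_subset)

lemma path_self [simp]: "x \<in> X \<Longrightarrow> path x x = {}"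
  by (rule path_eqI[symmetric]) (simp_all add: gd_nonneg)

lemma gd_self [simp]: "x \<in> X \<Longrightarrow> gd x x = 0"
  by (simp add: gd_def)

lemma gd_eq_0:
  assumes "x \<in> X" "y \<in> X" "gd x y = 0"
  shows "x = y"
proof -
  have "path x y = {}" using sum_le_0[OF path_subset] assms by (simp add: gd_def)
  then show ?thesis using joins_path[of x y] joins_empty_iff[of "{}" x y] assms by simp
qed

lemma joins_path_concat:
  assumes "x \<in> X" "y \<in> X" "z \<in> X"
  shows "joins (path x y \<triangle> path y z) x z"
  using assms by (intro joins_trans[of _ _ x y z] joins_path fin_sub path_subset)

lemma path_concat_subset:
  assumes "x \<in> X" "y \<in> X" "z \<in> X"
  shows "path x y \<triangle> path y z \<subseteq> E"
  using path_subset[of x y] path_subset[of y z] assms by blast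

lemma gd_triangle:
  assumes "x \<in> X" "y \<in> X" "z \<in> X"
  shows "gd x z \<le> gd x y + gd y z"
proof -
  have "gd x z \<le> sum w (path x y \<triangle> path y z)"
    using assms by (intro gd_le joins_path_concat path_concat_subset)
  also have "\<dots> \<le> gd x y + gd y z"
    unfolding gd_def using assms by (intro sum_sym_diff_le path_subset)
  finally show ?thesis .
qed

text \<open>The two parts share no edge: their symmetric difference still joins \<open>x\<close> to
  \<open>y\<close> and would undercut \<open>gd x y\<close> by twice the shared weight. So it has
  the weight of the shortest join, and uniqueness identifies the two.\<close>

lemma path_split:
  assumes "x \<in> X" "y \<in> X" "z \<in> seg x y"
  shows "path x y = path x z \<union> path z y"
proof -
  have z: "z \<in> X" and eq: "gd x z + gd z y = gd x y" using assms(3) by (simp_all add: seg_def)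
  let ?D = "path x z \<triangle> path z y"
  have sub: "path x z \<subseteq> E" "path z y \<subseteq> E" using path_subset assms(1,2) z by simp_all
  have int: "path x z \<inter> path z y \<subseteq> E" using sub by blast
  have D: "?D \<subseteq> E" "joins ?D x y"
    by (rule path_concat_subset joins_path_concat; use assms(1,2) z in blast)+
  have sumD: "sum w ?D = gd x z + gd z y - 2 * sum w (path x z \<inter> path z y)"
    using sum_sym_diff[OF fin_sub[OF sub(1)] fin_sub[OF sub(2)], of w] by (simp add: gd_def)
  moreover have "gd x y \<le> sum w ?D" using gd_le[OF assms(1,2) D] .
  ultimately have "sum w (path x z \<inter> path z y) \<le> 0" using eq by linarith
  then have empty: "path x z \<inter> path z y = {}" using sum_le_0[OF int] by blast
  have "sum w ?D \<le> gd x y" using sumD eq sum_nn[OF int] by linarith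
  then have "?D = path x y" using path_eqI[OF assms(1,2) D] by blast
  then show ?thesis using empty by blast
qed

lemma path_acyclic:
  assumes "x \<in> X" "y \<in> X" "A \<subseteq> path x y" "bd A = {}"
  shows "A = {}"
proof -
  have E: "path x y \<subseteq> E" using path_subset assms by auto
  have "bd (path x y - A) = bd (path x y)"
    using bd_Diff[OF fin_sub[OF E] assms(3)] assms(4) by simp
  then have "joins (path x y - A) x y"
    using joins_path[OF assms(1,2)] by (simp only: joins_def)
  then have "gd x y \<le> sum w (path x y - A)" using gd_le[OF assms(1,2)] E by blast
  moreover have "sum w (path x y) = sum w (path x y - A) + sum w A"
    using assms(3) fin_sub[OF E] by (intro sum.subset_diff)
  ultimately have "sum w A \<le> 0" by (simp add: gd_def)
  then show ?thesis using sum_le_0[of A] assms(3) E by blast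
qed

lemma path_sub_minimal:
  assumes "x \<in> X" "y \<in> X" "A \<subseteq> path x y" "joins A x y"
  shows "A = path x y"
  using assms path_subset[of x y] by (intro path_eqI) (auto simp: gd_def intro: sum_mono)

text \<open>\<open>A\<close> and the rest of the path join \<open>x\<close> to \<open>z\<close> and
  \<open>z\<close> to \<open>y\<close>. Their weights bound the two distances from above and add up
  to \<open>gd x y\<close>.\<close>

lemma seg_if_subjoin:
  assumes "x \<in> X" "y \<in> X" "z \<in> X" "A \<subseteq> path x y" "joins A x z"
  shows "z \<in> seg x y"
proof -
  have E: "path x y \<subseteq> E" using path_subset assms by auto
  have "joins (path x y - A) z y"
    using joins_Diff[OF fin_sub[OF E] assms(4) joins_path[OF assms(1,2)] assms(5)] .
  then have "gd z y \<le> sum w (path x y - A)" using gd_le[OF assms(3,2)] E by blast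
  moreover have "gd x z \<le> sum w A" using gd_le[OF assms(1,3) _ assms(5)] assms(4) E by blast
  moreover have "sum w (path x y) = sum w (path x y - A) + sum w A"
    using assms(4) fin_sub[OF E] by (intro sum.subset_diff)
  ultimately have "gd x z + gd z y \<le> gd x y" by (simp add: gd_def)
  then show ?thesis using gd_triangle[of x z y] assms(1,2,3) unfolding seg_def by simp
qed

text \<open>A join is not a sequence, so an initial part of the path up to \<open>z\<close> has to
  be constructed. After deletion of an edge \<open>e\<close> at \<open>z\<close>, the partner of
  \<open>x\<close> among the remaining odd vertices marks the end of such a part; if that end is
  \<open>z'\<close>, adding \<open>e\<close> leads on to \<open>z\<close>.\<close>

lemma verts_path_subset_seg:
  assumes "x \<in> X" "y \<in> X"
  shows "verts (path x y) \<subseteq> seg x y"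
proof
  fix z assume z: "z \<in> verts (path x y)"
  let ?D = "path x y"
  have E: "?D \<subseteq> E" using path_subset assms by auto
  have finD: "finite ?D" using fin_sub E by auto
  obtain e where e: "e \<in> ?D" "l e = z \<or> r e = z" using z unfolding verts_def by auto
  define z' where "z' = (if l e = z then r e else l e)"
  have zX: "z \<in> X" "z' \<in> X" using e E ends unfolding z'_def by (auto simp: subset_iff)
  have je: "joins {e} z z'"
  proof (cases "l e = z")
    case False
    then show ?thesis using joins_sym[OF joins_edge[of e]] e(2) unfolding z'_def by simp
  qed (use joins_edge[of e] z'_def in auto)
  show "z \<in> seg x y"
  proof (cases "x = z \<or> x = z' \<or> x = y")
    case True
    \<comment> \<open>These cases are apart because \<open>x\<close> would not be odd after the
      deletion of \<open>e\<close>.\<close>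
    have "z \<in> seg x y" if "x = z" using seg_if_subjoin[OF assms zX(1), of "{}"] that by simp
    moreover have "z \<in> seg x y" if "x = z'"
      using seg_if_subjoin[OF assms zX(1), of "{e}"] joins_sym[OF je] that e(1) by simp
    moreover have "x \<noteq> y" using e(1) assms by auto
    ultimately show ?thesis using True by blast
  next
    case False
    have "bd (?D - {e}) = ({x} \<triangle> {y}) \<triangle> ({z} \<triangle> {z'})"
      using bd_Diff[OF finD, of "{e}"] e(1) joins_path[OF assms] je unfolding joins_def by simp
    then have bdr: "v \<in> bd (?D - {e}) \<longleftrightarrow> v \<in> ({x} \<triangle> {y}) \<triangle> ({z} \<triangle> {z'})" for v by simp
    have "x \<in> bd (?D - {e})" using False by (simp add: bdr)
    then obtain v A where v: "v \<in> bd (?D - {e})" "v \<noteq> x" "A \<subseteq> ?D - {e}" "bd A = {x, v}"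
      using join_partner[of "?D - {e}" x] finD by blast
    have jA: "joins A x v" using v(2,4) joins_iff[of x v] by blast
    \<comment> \<open>A join from \<open>x\<close> to \<open>y\<close> avoiding \<open>e\<close>
      would be a proper part of the shortest join.\<close>
    have "v \<noteq> y" using path_sub_minimal[OF assms, of A] v(3) e(1) jA by blast
    then consider "v = z" | "v = z'" using v(1,2) unfolding bdr by blast
    then show ?thesis
    proof cases
      case 1
      then show ?thesis using seg_if_subjoin[OF assms zX(1), of A] v(3) jA by blast
    next
      case 2
      have "joins (A \<triangle> {e}) x z"
        using joins_trans[OF _ _ jA, of "{e}" z] joins_sym[OF je] 2 v(3) finD by (auto intro: finite_subset)
      moreover have "A \<triangle> {e} \<subseteq> ?D" using v(3) e(1) by blast
      ultimately show ?thesis using seg_if_subjoin[OF assms zX(1)] by blast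
    qed
  qed
qed

section \<open>Order and distance along a geodesic\<close>

lemma seg_in: "z \<in> seg x y \<Longrightarrow> z \<in> X"
  unfolding seg_def by auto

lemma seg_eq:
  assumes "x \<in> X" "y \<in> X"
  shows "z \<in> seg x y \<longleftrightarrow> z = x \<or> z \<in> verts (path x y)"
proof
  assume z: "z \<in> seg x y"
  have "z \<in> verts (path x y)" if "z \<noteq> x"
    using that joins_in_bd[OF joins_sym[OF joins_path[of x z]]] bd_subset_verts[of "path x z"]
      verts_mono[of "path x z" "path x y"] path_split[OF assms z] assms seg_in[OF z] by blast
  then show "z = x \<or> z \<in> verts (path x y)" by auto
next
  assume "z = x \<or> z \<in> verts (path x y)"
  then show "z \<in> seg x y" using verts_path_subset_seg[OF assms] assms by (auto simp: seg_def)
qed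

text \<open>A vertex of the path lies before or after \<open>y\<close>; one that lies after
  \<open>y\<close> without being farther from \<open>u\<close> is \<open>y\<close> itself.\<close>

lemma seg_ordered:
  assumes "u \<in> X" "v \<in> X" "x \<in> seg u v" "y \<in> seg u v" "gd u x \<le> gd u y"
  shows "x \<in> seg u y"
proof (cases "x \<in> seg u y")
  case False
  have X: "x \<in> X" "y \<in> X" using assms seg_in by auto
  have "x \<noteq> u" using False X assms by (auto simp: seg_def)
  then have "x \<in> verts (path u v)" using assms seg_eq by blast
  then have "x \<in> verts (path u y) \<or> x \<in> verts (path y v)"
    using path_split[OF assms(1,2,4)] verts_Un by auto
  then have "x \<in> seg y v" using False verts_path_subset_seg X assms by blast
  then have "gd y x = 0" using assms(3,4,5) X gd_nonneg[of y x] by (auto simp: seg_def)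
  then have "x = y" using gd_eq_0 X by blast
  then show ?thesis using X assms by (auto simp: seg_def)
qed

text \<open>A geodesic is isometric to a set of reals with coordinate \<open>gd u\<close>. This is
  how the portal argument sees a separator.\<close>

lemma gd_along:
  assumes "u \<in> X" "v \<in> X" "x \<in> seg u v" "y \<in> seg u v"
  shows "gd x y = \<bar>gd u x - gd u y\<bar>"
proof -
  have X: "x \<in> X" "y \<in> X" using assms seg_in by auto
  show ?thesis
  proof (cases "gd u x \<le> gd u y")
    case True
    then show ?thesis using seg_ordered[OF assms] by (auto simp: seg_def)
  next
    case False
    then show ?thesis using seg_ordered[OF assms(1,2,4,3)] gd_sym X by (auto simp: seg_def)
  qed
qed

lemma path_between_subset:
  assumes "u \<in> X" "v \<in> X" "x \<in> seg u v" "y \<in> seg u v"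
  shows "path x y \<subseteq> path u v"
proof -
  have X: "x \<in> X" "y \<in> X" using assms seg_in by auto
  have *: "path x y \<subseteq> path u v" if "x \<in> seg u v" "y \<in> seg u v" "gd u x \<le> gd u y" for x y
    using path_split[OF assms(1,2) that(2)] seg_ordered[OF assms(1,2) that] path_split[of u y x]
      seg_in that assms by blast
  show ?thesis
  proof (cases "gd u x \<le> gd u y")
    case True
    then show ?thesis using * assms by blast
  next
    case False
    then show ?thesis using *[of y x] path_sym[of x y] X assms by auto
  qed
qed

text \<open>Counted are the vertices of the first path at which the second one leaves it. Of three
  of them, ordered along the second path, the outer two bound a stretch that both paths share by
  uniqueness. The edge leaving at the middle one would then lie before or after that stretch,
  against the order.\<close>

lemma geodesics_branch_le_2:
  assumes X: "p \<in> X" "p' \<in> X" "q \<in> X" "q' \<in> X"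
  shows "card (verts (path p p') \<inter> verts (path q q' - path p p')) \<le> 2" (is "card ?B \<le> 2")
proof (rule ccontr)
  let ?P = "path p p'" and ?Q = "path q q'"
  assume "\<not> card ?B \<le> 2"
  then have c3: "3 \<le> card ?B" by simp
  have "?B \<subseteq> seg p p'" using verts_path_subset_seg[OF X(1,2)] by blast
  moreover have "?B \<subseteq> seg q q'"
    using verts_path_subset_seg[OF X(3,4)] verts_mono[of "?Q - ?P" ?Q] by blast
  ultimately have B: "z \<in> seg p p'" "z \<in> seg q q'" if "z \<in> ?B" for z
    using that by blast+
  have inj: "z = z'" if z: "z \<in> ?B" "z' \<in> ?B" and eq: "gd q z = gd q z'" for z z'
  proof -
    have "gd z z' = 0" using gd_along[OF X(3,4) B(2)[OF z(1)] B(2)[OF z(2)]] eq by simp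
    then show ?thesis using gd_eq_0 seg_in B(1) z by blast
  qed
  have finB: "finite ?B" using c3 by (intro card_ge_0_finite) linarith
  \<comment> \<open>\<open>gd q\<close> is injective on the branch vertices, so three of them yield
    a minimum, a maximum and a value strictly in between.\<close>
  define N where "N = gd q ` ?B"
  have "inj_on (gd q) ?B" using inj by (rule inj_onI)
  then have cN: "3 \<le> card N" unfolding N_def using c3 by (simp only: card_image)
  have finN: "finite N" unfolding N_def using finB by (rule finite_imageI)
  define a c where "a = Min N" and "c = Max N"
  have "N \<noteq> {}" using cN by auto
  then have ac: "a \<in> N" "c \<in> N" using finN a_def c_def by auto
  have "card {a, c} \<le> 2" by (cases "a = c") auto
  then have "\<not> N \<subseteq> {a, c}" using cN card_mono[of "{a, c}" N] by auto
  then obtain b where b: "b \<in> N" "b \<noteq> a" "b \<noteq> c" by auto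
  then have abc: "a < b" "b < c" using finN a_def c_def by (auto simp: order_less_le)
  obtain x y z where xyz: "x \<in> ?B" "y \<in> ?B" "z \<in> ?B" "gd q x = a" "gd q y = b" "gd q z = c"
    using ac b(1) unfolding N_def by blast
  have XX: "x \<in> X" "y \<in> X" "z \<in> X" using B xyz seg_in by blast+
  have xzP: "path x z \<subseteq> ?P" using path_between_subset B xyz X by blast
  have zq: "z \<in> seg q q'" using B(2) xyz(3) .
  moreover have "x \<in> seg q z"
    using seg_ordered[OF X(3,4) B(2)[OF xyz(1)] zq] xyz(4,6) abc by simp
  ultimately have Qsplit: "?Q = path q x \<union> path x z \<union> path z q'"
    using path_split[OF X(3,4), of z] path_split[OF X(3) XX(3), of x] by blast
  obtain e where e: "e \<in> ?Q - ?P" "l e = y \<or> r e = y" using xyz(2) unfolding verts_def by auto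
  consider "e \<in> path q x" | "e \<in> path z q'" using e(1) Qsplit xzP by blast
  then show False
  proof cases
    case 1
    then have "y \<in> seg q x" using verts_path_subset_seg[OF X(3) XX(1)] e(2) unfolding verts_def by blast
    then show False using gd_nonneg[OF XX(2,1)] abc xyz(4,5) by (simp add: seg_def)
  next
    case 2
    then have "y \<in> seg z q'" using verts_path_subset_seg[OF XX(3) X(4)] e(2) unfolding verts_def by blast
    moreover have "y \<in> seg q q'" using B(2) xyz(2) .
    ultimately show False using zq gd_nonneg[OF XX(3,2)] abc xyz(5,6) by (simp add: seg_def)
  qed
qed

text \<open>The relative cycle space of \<open>F\<close> modulo \<open>K\<close> over GF(2). Bounds
  on its size are bounds on its dimension, which is the base-2 logarithm.\<close>

definition closed_sub :: "'b set \<Rightarrow> 'e set \<Rightarrow> 'e set set" where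
  "closed_sub K F = {D. D \<subseteq> F \<and> bd D \<subseteq> K}"

text \<open>The part of a set outside \<open>F\<close> lies in a single path, so its boundary
  determines it by \<open>path_acyclic\<close>, and that boundary is confined to \<open>Y\<close>:
  this leaves \<open>2 ^ card Y\<close> choices. Two sets with the same outer part differ by a
  relative cycle within \<open>F\<close>.\<close>

lemma card_closed_sub_Un_path:
  assumes x: "x \<in> X" "y \<in> X" and F: "F \<subseteq> E"
    and Y: "finite Y" "K \<subseteq> Y" "verts F \<inter> verts (path x y - F) \<subseteq> Y"
  shows "card (closed_sub K (F \<union> path x y)) \<le> card (closed_sub K F) * 2 ^ card Y"
proof -
  let ?Q = "path x y"
  let ?Z = "closed_sub K (F \<union> ?Q)"
  have QE: "?Q \<subseteq> E" using path_subset x by auto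
  define g where "g C = C - F" for C :: "'e set"
  \<comment> \<open>One fixed representative for each outer part; adding it modulo 2 moves
    \<open>C\<close> into \<open>F\<close>.\<close>
  define s where "s A = (SOME C. C \<in> ?Z \<and> g C = A)" for A
  have s: "s (g C) \<in> ?Z \<and> g (s (g C)) = g C" if "C \<in> ?Z" for C
    unfolding s_def by (rule someI[of _ C]) (use that in auto)
  have bdY: "bd (g C) \<subseteq> Y" if "C \<in> ?Z" for C
  proof -
    have "C \<subseteq> F \<union> ?Q" "bd C \<subseteq> K" using that closed_sub_def by auto
    then have finC: "finite C" using fin_sub[of C] F QE by auto
    have "g C = C - (C \<inter> F)" unfolding g_def by auto
    then have "bd (g C) = bd C \<triangle> bd (C \<inter> F)" using bd_Diff[OF finC, of "C \<inter> F"] by auto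
    moreover have "bd (C \<inter> F) \<subseteq> verts F" using bd_subset_verts verts_mono[of "C \<inter> F" F] by blast
    moreover have "bd (g C) \<subseteq> verts (?Q - F)"
      using bd_subset_verts verts_mono[of "g C" "?Q - F"] \<open>C \<subseteq> F \<union> ?Q\<close> unfolding g_def by blast
    ultimately show ?thesis using Y \<open>bd C \<subseteq> K\<close> by auto
  qed
  have fine: "finite C" if "C \<in> ?Z" for C
    using that fin_sub[of C] F QE unfolding closed_sub_def by auto
  have geq: "g C = g C'" if "C \<in> ?Z" "C' \<in> ?Z" "bd (g C) = bd (g C')" for C C'
  proof -
    have sub: "g C \<subseteq> ?Q" "g C' \<subseteq> ?Q" using that unfolding closed_sub_def g_def by auto
    then have "finite (g C)" "finite (g C')" using fin_sub QE by auto
    then have "bd (g C \<triangle> g C') = {}" using bd_sym_diff[of "g C" "g C'"] that by auto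
    then show ?thesis using path_acyclic[OF x, of "g C \<triangle> g C'"] sub by blast
  qed
  define h where "h C = (C \<triangle> s (g C), bd (g C))" for C
  have "inj_on h ?Z"
  proof (rule inj_onI)
    fix C C' assume C: "C \<in> ?Z" "C' \<in> ?Z" "h C = h C'"
    then have "g C = g C'" using geq unfolding h_def by auto
    then show "C = C'" using C unfolding h_def by auto
  qed
  moreover have "h ` ?Z \<subseteq> closed_sub K F \<times> Pow Y"
  proof
    fix p assume "p \<in> h ` ?Z"
    then obtain C where C: "C \<in> ?Z" "p = h C" by auto
    have "C \<triangle> s (g C) \<subseteq> F" using s[OF C(1)] unfolding g_def by auto
    moreover have "bd (C \<triangle> s (g C)) \<subseteq> K"
      using bd_sym_diff[of C "s (g C)"] fine s[OF C(1)] C(1) unfolding closed_sub_def by auto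
    ultimately show "p \<in> closed_sub K F \<times> Pow Y" using C bdY unfolding closed_sub_def h_def by auto
  qed
  moreover have "finite (closed_sub K F \<times> Pow Y)"
    using Y fin_sub[OF F] unfolding closed_sub_def by auto
  ultimately have "card ?Z \<le> card (closed_sub K F \<times> Pow Y)" by (meson card_inj_on_le)
  then show ?thesis using Y by (simp add: card_cartesian_product card_Pow)
qed

text \<open>Each of n earlier paths contributes at most two branch vertices, so the next path adds
  at most \<open>2 * n + card K\<close> to the exponent.\<close>

lemma card_closed_sub_Union_paths:
  assumes "finite \<P>" "finite K" "\<And>P. P \<in> \<P> \<Longrightarrow> \<exists>x\<in>X. \<exists>y\<in>X. P = path x y"
  shows "card (closed_sub K (\<Union>\<P>)) \<le> 2 ^ (card \<P> * (2 * card \<P> + card K))"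
  using assms(1,3)
proof (induction \<P> rule: finite_induct)
  case empty
  have "closed_sub K {} = {{}}" unfolding closed_sub_def by auto
  then show ?case by simp
next
  case (insert Q \<P>)
  obtain x y where xy: "x \<in> X" "y \<in> X" "Q = path x y" using insert.prems[of Q] by blast
  define b where "b P = verts P \<inter> verts (Q - P)" for P
  define Y where "Y = K \<union> (\<Union>P\<in>\<P>. b P)"
  have sub: "P \<subseteq> E" if "P \<in> \<P>" for P using insert.prems that path_subset by blast
  have b2: "card (b P) \<le> 2" if P: "P \<in> \<P>" for P
  proof -
    obtain p p' where "p \<in> X" "p' \<in> X" "P = path p p'" using insert.prems P by blast
    then show ?thesis using geodesics_branch_le_2 xy unfolding b_def by blast
  qed
  have finb: "finite (b P)" if "P \<in> \<P>" for P
    unfolding b_def using finite_verts fin_sub sub that by blast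
  have finY: "finite Y" unfolding Y_def using assms(2) insert.hyps finb by auto
  have "card Y \<le> card K + card (\<Union>P\<in>\<P>. b P)" unfolding Y_def by (rule card_Un_le)
  also have "card (\<Union>P\<in>\<P>. b P) \<le> (\<Sum>P\<in>\<P>. card (b P))" using insert.hyps(1) by (rule card_UN_le)
  also have "\<dots> \<le> card \<P> * 2" using sum_bounded_above[of \<P> "\<lambda>P. card (b P)" 2] b2 by simp
  finally have cY: "card Y \<le> card K + card \<P> * 2" by simp
  have "verts (\<Union>\<P>) \<inter> verts (Q - \<Union>\<P>) \<subseteq> Y"
    unfolding Y_def b_def verts_def by auto
  then have "card (closed_sub K (\<Union>\<P> \<union> Q)) \<le> card (closed_sub K (\<Union>\<P>)) * 2 ^ card Y"
    unfolding xy(3) using xy finY Y_def sub by (intro card_closed_sub_Un_path) auto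
  also have "\<dots> \<le> 2 ^ (card \<P> * (2 * card \<P> + card K)) * 2 ^ (card K + card \<P> * 2)"
    using insert.IH insert.prems cY by (intro mult_mono power_increasing) auto
  also have "\<dots> = 2 ^ (card \<P> * (2 * card \<P> + card K) + (card K + card \<P> * 2))"
    by (simp add: power_add)
  also have "\<dots> \<le> 2 ^ (card (insert Q \<P>) * (2 * card (insert Q \<P>) + card K))"
    using insert.hyps by (intro power_increasing) (auto simp: algebra_simps)
  finally show ?case by (simp add: Un_commute)
qed

end

section \<open>Portals and the spanner of the gaps\<close>

text \<open>Think of \<open>f\<close> as the distance from a source, \<open>pos\<close> as the
  coordinate on a line, and \<open>d\<close> and \<open>p0\<close> as these values at the nearest
  point. Going through \<open>p\<close> to a later \<open>q\<close> costs
  \<open>(pos q - f q) - (pos p - f p)\<close> more than \<open>f q\<close>. The distance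
  inequalities confine \<open>pos - f\<close> to an interval of length \<open>2 * d\<close>; it is
  cut into classes of width \<open>\<epsilon> * d\<close>, and the first point of each class serves
  the class.\<close>

lemma one_sided_portals:
  fixes pos f :: "'b \<Rightarrow> real"
  assumes S: "finite S" and pos: "0 < \<epsilon>" "0 < d"
    and ge: "\<And>x. x \<in> S \<Longrightarrow> d \<le> f x \<and> p0 \<le> pos x"
    and near: "\<And>x. x \<in> S \<Longrightarrow> \<bar>f x - d\<bar> \<le> pos x - p0 \<and> pos x - p0 \<le> f x + d"
  shows "\<exists>R\<subseteq>S. real (card R) \<le> 2 / \<epsilon> + 1 \<and>
    (\<forall>q\<in>S. \<exists>p\<in>R. f p + \<bar>pos p - pos q\<bar> \<le> (1 + \<epsilon>) * f q)"
proof -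
  \<comment> \<open>The value \<open>pos x - f x\<close>, shifted to start at 0 and measured in
    units of \<open>\<epsilon> * d\<close>.\<close>
  define u where "u x = (d - p0 - f x + pos x) / (\<epsilon> * d)" for x
  define j where "j x = nat \<lfloor>u x\<rfloor>" for x
  have u: "0 \<le> u x" "u x \<le> 2 / \<epsilon>" if "x \<in> S" for x
  proof -
    have "0 \<le> d - p0 - f x + pos x" "d - p0 - f x + pos x \<le> 2 * d" using near[OF that] by linarith+
    then have "0 \<le> u x \<and> u x \<le> 2 * d / (\<epsilon> * d)"
      unfolding u_def
        using mult_pos_pos[OF pos] by (intro conjI divide_right_mono) (simp_all only: divide_nonneg_pos less_imp_le)
    then show "0 \<le> u x" "u x \<le> 2 / \<epsilon>" using pos by simp_all
  qed
  define m where "m n = arg_min_on pos {x \<in> S. j x = n}" for n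
  define R where "R = m ` j ` S"
  have m: "m (j q) \<in> S" "j (m (j q)) = j q" "pos (m (j q)) \<le> pos q" if "q \<in> S" for q
  proof -
    have fin: "finite {x \<in> S. j x = j q}" and ne: "{x \<in> S. j x = j q} \<noteq> {}" using S that by auto
    show "m (j q) \<in> S" "j (m (j q)) = j q" "pos (m (j q)) \<le> pos q"
      using arg_min_if_finite[OF fin ne, of pos] that unfolding m_def by (simp_all add: not_less)
  qed
  have jsub: "j ` S \<subseteq> {..nat \<lfloor>2 / \<epsilon>\<rfloor>}"
    unfolding j_def using u(2) by (auto intro!: nat_mono floor_mono)
  have "card R \<le> card (j ` S)" unfolding R_def using S by (intro card_image_le) auto
  also have "\<dots> \<le> nat \<lfloor>2 / \<epsilon>\<rfloor> + 1" using card_mono[OF _ jsub] by simp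
  finally have "real (card R) \<le> real (nat \<lfloor>2 / \<epsilon>\<rfloor>) + 1" by linarith
  also have "\<dots> \<le> 2 / \<epsilon> + 1" using pos by simp
  finally have "real (card R) \<le> 2 / \<epsilon> + 1" .
  moreover have "R \<subseteq> S" unfolding R_def using m by auto
  moreover have "\<exists>p\<in>R. f p + \<bar>pos p - pos q\<bar> \<le> (1 + \<epsilon>) * f q" if q: "q \<in> S" for q
  proof (rule bexI[of _ "m (j q)"])
    let ?p = "m (j q)"
    have "\<lfloor>u ?p\<rfloor> = \<lfloor>u q\<rfloor>" using m[OF q] u(1)[OF q] u(1)[OF m(1)[OF q]] unfolding j_def
      by (metis eq_nat_nat_iff zero_le_floor)
    then have "u q - u ?p \<le> 1" by linarith
    moreover have "u q - u ?p = (pos q - f q - (pos ?p - f ?p)) / (\<epsilon> * d)"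
      unfolding u_def by (simp flip: diff_divide_distrib)
    ultimately have "pos q - f q - (pos ?p - f ?p) \<le> \<epsilon> * d" using pos by (simp add: field_simps)
    also have "\<dots> \<le> \<epsilon> * f q" using pos ge[OF q] by simp
    finally show "f ?p + \<bar>pos ?p - pos q\<bar> \<le> (1 + \<epsilon>) * f q" using m[OF q] by (simp add: algebra_simps)
    show "?p \<in> R" using q R_def by auto
  qed
  ultimately show ?thesis by blast
qed

text \<open>The nearest point \<open>p0\<close> divides the line into two sides, the lower one
  handled by negating \<open>pos\<close>. At distance 0 the classes would have width 0, but then
  \<open>p0\<close> alone is an exact portal.\<close>

lemma portals_on_line:
  fixes pos f :: "'b \<Rightarrow> real"
  assumes S: "finite S" "S \<noteq> {}" and eps: "0 < \<epsilon>"
    and lip: "\<And>x y. x \<in> S \<Longrightarrow> y \<in> S \<Longrightarrow> \<bar>f x - f y\<bar> \<le> \<bar>pos x - pos y\<bar>"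
    and tri: "\<And>x y. x \<in> S \<Longrightarrow> y \<in> S \<Longrightarrow> \<bar>pos x - pos y\<bar> \<le> f x + f y"
  shows "\<exists>R\<subseteq>S. real (card R) \<le> 4 / \<epsilon> + 2 \<and>
    (\<forall>q\<in>S. \<exists>p\<in>R. f p + \<bar>pos p - pos q\<bar> \<le> (1 + \<epsilon>) * f q)"
proof -
  obtain p0 where p0: "p0 \<in> S" "\<And>x. x \<in> S \<Longrightarrow> f p0 \<le> f x"
    using arg_min_if_finite[OF S, of f] by (meson not_le)
  define d where "d = f p0"
  have d0: "0 \<le> d" unfolding d_def using tri[OF p0(1) p0(1)] by simp
  show ?thesis
  proof (cases "d = 0")
    case True
    have "f p0 + \<bar>pos p0 - pos q\<bar> \<le> (1 + \<epsilon>) * f q" if "q \<in> S" for q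
    proof -
      have "f p0 + \<bar>pos p0 - pos q\<bar> \<le> f q" using tri[OF p0(1) that] True d_def by simp
      also have "\<dots> \<le> (1 + \<epsilon>) * f q" using p0(2)[OF that] True d_def eps by (simp add: algebra_simps)
      finally show ?thesis .
    qed
    moreover have "real (card {p0}) \<le> 4 / \<epsilon> + 2" using eps by simp
    ultimately show ?thesis using p0(1) by (intro exI[of _ "{p0}"]) auto
  next
    case False
    then have d: "0 < d" using d0 by simp
    define S1 where "S1 = {x \<in> S. pos p0 \<le> pos x}"
    define S2 where "S2 = {x \<in> S. pos x \<le> pos p0}"
    have "\<exists>R\<subseteq>S1. real (card R) \<le> 2 / \<epsilon> + 1 \<and>
      (\<forall>q\<in>S1. \<exists>p\<in>R. f p + \<bar>pos p - pos q\<bar> \<le> (1 + \<epsilon>) * f q)"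
    proof (rule one_sided_portals[where d = d and ?p0.0 = "pos p0"])
      fix x assume "x \<in> S1"
      then show "d \<le> f x \<and> pos p0 \<le> pos x" "\<bar>f x - d\<bar> \<le> pos x - pos p0 \<and> pos x - pos p0 \<le> f x + d"
        using p0 lip[of x p0] tri[of x p0] unfolding S1_def d_def by auto
    qed (use S eps d S1_def in auto)
    then obtain R1 where R1: "R1 \<subseteq> S1" "real (card R1) \<le> 2 / \<epsilon> + 1"
      "\<And>q. q \<in> S1 \<Longrightarrow> \<exists>p\<in>R1. f p + \<bar>pos p - pos q\<bar> \<le> (1 + \<epsilon>) * f q" by blast
    have "\<exists>R\<subseteq>S2. real (card R) \<le> 2 / \<epsilon> + 1 \<and>
      (\<forall>q\<in>S2. \<exists>p\<in>R. f p + \<bar>- pos p - - pos q\<bar> \<le> (1 + \<epsilon>) * f q)"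
    proof (rule one_sided_portals[where d = d and ?p0.0 = "- pos p0"])
      fix x assume "x \<in> S2"
      then show "d \<le> f x \<and> - pos p0 \<le> - pos x"
        "\<bar>f x - d\<bar> \<le> - pos x - - pos p0 \<and> - pos x - - pos p0 \<le> f x + d"
        using p0 lip[of x p0] tri[of x p0] unfolding S2_def d_def by auto
    qed (use S eps d S2_def in auto)
    then obtain R2 where R2: "R2 \<subseteq> S2" "real (card R2) \<le> 2 / \<epsilon> + 1"
      "\<And>q. q \<in> S2 \<Longrightarrow> \<exists>p\<in>R2. f p + \<bar>pos p - pos q\<bar> \<le> (1 + \<epsilon>) * f q"
      by (metis abs_minus_commute minus_diff_minus abs_minus_cancel)
    have "real (card (R1 \<union> R2)) \<le> 4 / \<epsilon> + 2" using card_Un_le[of R1 R2] R1(2) R2(2) by linarith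
    moreover have "q \<in> S1 \<or> q \<in> S2" if "q \<in> S" for q using that unfolding S1_def S2_def by auto
    moreover have "R1 \<union> R2 \<subseteq> S" using R1(1) R2(1) unfolding S1_def S2_def by auto
    ultimately show ?thesis using R1(3) R2(3) by (intro exI[of _ "R1 \<union> R2"]) blast
  qed
qed

text \<open>\<open>Suc s\<close> is the first level at which \<open>i\<close> and \<open>j\<close>
  lie in the same dyadic block. One level below they lie in different halves, so the midpoint
  \<open>lo + 2 ^ s\<close> separates them.\<close>

lemma dyadic_separation:
  fixes i j :: nat
  assumes "i < j"
  obtains s lo where "lo = i div 2 ^ Suc s * 2 ^ Suc s" "lo = j div 2 ^ Suc s * 2 ^ Suc s"
    "lo \<le> i" "i < lo + 2 ^ s" "lo + 2 ^ s \<le> j"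
proof -
  define n where "n = (LEAST s. i div 2 ^ s = j div 2 ^ s)"
  have "j < 2 ^ j" by (rule less_exp)
  then have "i div 2 ^ j = j div 2 ^ j" using assms order.strict_trans[of i j "2 ^ j"] by simp
  then have n: "i div 2 ^ n = j div 2 ^ n" unfolding n_def by (rule LeastI)
  have "n \<noteq> 0"
  proof
    assume "n = 0"
    then show False using n assms by simp
  qed
  then obtain s where s: "n = Suc s" using not0_implies_Suc by blast
  then have "i div 2 ^ s \<noteq> j div 2 ^ s"
    using not_less_Least[of s "\<lambda>s. i div 2 ^ s = j div 2 ^ s"] unfolding n_def[symmetric] by simp
  moreover have "i div 2 ^ s \<le> j div 2 ^ s" using assms by (simp add: div_le_mono)
  ultimately have lt: "i div 2 ^ s < j div 2 ^ s" by simp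
  define t where "t = i div 2 ^ Suc s"
  have t: "i div 2 ^ s div 2 = t" "j div 2 ^ s div 2 = t" "j div 2 ^ Suc s = t"
    using n unfolding t_def s by (simp_all only: power_Suc2 div_mult2_eq)
  then have eq: "i div 2 ^ s = 2 * t" "j div 2 ^ s = 2 * t + 1" using lt by linarith+
  show ?thesis
  proof (rule that[of "t * 2 ^ Suc s" s])
    show "t * 2 ^ Suc s \<le> i" unfolding t_def by (rule div_times_less_eq_dividend)
    have "i < (i div 2 ^ s + 1) * 2 ^ s"
      by (metis add.commute dividend_less_times_div mult.commute mult_Suc_right plus_1_eq_Suc zero_less_numeral zero_less_power)
    then show "i < t * 2 ^ Suc s + 2 ^ s" unfolding eq by (simp add: algebra_simps)
    have "j div 2 ^ s * 2 ^ s \<le> j" by (rule div_times_less_eq_dividend)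
    then show "t * 2 ^ Suc s + 2 ^ s \<le> j" unfolding eq by (simp add: algebra_simps)
    show "t * 2 ^ Suc s = i div 2 ^ Suc s * 2 ^ Suc s" by (simp only: t_def)
    show "t * 2 ^ Suc s = j div 2 ^ Suc s * 2 ^ Suc s" by (simp only: t(3))
  qed
qed

lemma card_powers_below:
  assumes "1 \<le> k"
  shows "finite {s. 2 ^ s < (k :: nat)}" "real (card {s. 2 ^ s < k}) \<le> log 2 (real k) + 1"
proof -
  have sub: "{s. 2 ^ s < k} \<subseteq> {..nat \<lfloor>log 2 (real k)\<rfloor>}"
  proof
    fix s :: nat assume "s \<in> {s. 2 ^ s < k}"
    then have "(2::real) ^ s \<le> real k" by (metis less_imp_le mem_Collect_eq of_nat_le_iff of_nat_numeral of_nat_power)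
    then have "real s \<le> log 2 (real k)" using assms by (simp add: le_log_iff powr_realpow)
    then show "s \<in> {..nat \<lfloor>log 2 (real k)\<rfloor>}" by (simp add: le_nat_floor)
  qed
  show "finite {s. 2 ^ s < k}" using finite_subset[OF sub] by simp
  have "card {s. 2 ^ s < k} \<le> nat \<lfloor>log 2 (real k)\<rfloor> + 1" using card_mono[OF _ sub] by simp
  moreover have "real (nat \<lfloor>log 2 (real k)\<rfloor>) \<le> log 2 (real k)" using assms by simp
  ultimately show "real (card {s. 2 ^ s < k}) \<le> log 2 (real k) + 1" by linarith
qed

section \<open>Detours through portals on dyadic separators\<close>

context geodesic_graph
begin

lemma finite_seg:
  assumes "u \<in> X" "v \<in> X"
  shows "finite (seg u v)"
proof -
  have "seg u v \<subseteq> insert u (verts (path u v))" using seg_eq[OF assms] by auto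
  then show ?thesis using finite_verts[OF fin_sub[OF path_subset[OF assms]]] finite_subset by auto
qed

lemma geodesic_portals:
  assumes X: "u \<in> X" "v \<in> X" "i \<in> X" and eps: "0 < \<epsilon>"
  shows "\<exists>R\<subseteq>seg u v. real (card R) \<le> 4 / \<epsilon> + 2 \<and>
    (\<forall>q\<in>seg u v. \<exists>p\<in>R. gd i p + gd p q \<le> (1 + \<epsilon>) * gd i q)"
proof -
  have along: "gd x y = \<bar>gd u x - gd u y\<bar>" if "x \<in> seg u v" "y \<in> seg u v" for x y
    using gd_along X that by blast
  have tri: "gd i x \<le> gd i y + gd x y" "gd x y \<le> gd i x + gd i y" if "x \<in> seg u v" "y \<in> seg u v" for x y
    using gd_triangle[of i y x] gd_triangle[of x i y] gd_sym[of x i] gd_sym[of x y] X seg_in that by auto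
  have "u \<in> seg u v" using seg_eq X by blast
  then have ne: "seg u v \<noteq> {}" by blast
  have "\<exists>R\<subseteq>seg u v. real (card R) \<le> 4 / \<epsilon> + 2 \<and>
    (\<forall>q\<in>seg u v. \<exists>p\<in>R. gd i p + \<bar>gd u p - gd u q\<bar> \<le> (1 + \<epsilon>) * gd i q)"
  proof (rule portals_on_line[OF finite_seg[OF X(1,2)] ne eps])
    fix x y assume xy: "x \<in> seg u v" "y \<in> seg u v"
    show "\<bar>gd i x - gd i y\<bar> \<le> \<bar>gd u x - gd u y\<bar>"
      using tri(1)[OF xy] tri(1)[OF xy(2,1)] along[OF xy] along[OF xy(2,1)] by linarith
    show "\<bar>gd u x - gd u y\<bar> \<le> gd i x + gd i y"
      using tri(2)[OF xy] along[OF xy] by linarith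
  qed
  then obtain R where R: "R \<subseteq> seg u v" "real (card R) \<le> 4 / \<epsilon> + 2"
    "\<And>q. q \<in> seg u v \<Longrightarrow> \<exists>p\<in>R. gd i p + \<bar>gd u p - gd u q\<bar> \<le> (1 + \<epsilon>) * gd i q" by blast
  have "\<exists>p\<in>R. gd i p + gd p q \<le> (1 + \<epsilon>) * gd i q" if q: "q \<in> seg u v" for q
  proof -
    obtain p where p: "p \<in> R" "gd i p + \<bar>gd u p - gd u q\<bar> \<le> (1 + \<epsilon>) * gd i q"
      using R(3)[OF q] by blast
    then show ?thesis using along[of p q] q R(1) by (intro bexI[of _ p]) auto
  qed
  then show ?thesis using R(1,2) by blast
qed

text \<open>All that is needed from planarity is \<open>cross\<close>. For \<open>i < j\<close> the
  separator of their dyadic block meets the shortest path between them in some \<open>q\<close>.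
  Detours over portals from both ends to \<open>q\<close> are stretched by at most
  \<open>1 + \<epsilon>\<close> each, and the exact distances add up because \<open>q\<close> lies
  on the shortest path.\<close>

lemma spanner:
  fixes g :: "nat \<Rightarrow> 'b" and k :: nat
  assumes k: "1 \<le> k" and gX: "\<And>i. i < k \<Longrightarrow> g i \<in> X" and eps: "0 < \<epsilon>"
    and cross: "\<And>a b i j P Q. \<lbrakk>a \<le> i; i < b; b \<le> j; j < k; P \<subseteq> E; joins P (g a) (g b);
      Q \<subseteq> E; joins Q (g i) (g j)\<rbrakk> \<Longrightarrow> verts P \<inter> verts Q \<noteq> {}"
  shows "\<exists>F N. F \<subseteq> E \<and>
    (\<forall>i<k. \<forall>j<k. i \<noteq> j \<longrightarrow> (\<forall>Q\<subseteq>E. joins Q (g i) (g j) \<longrightarrow>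
      (\<exists>Q'\<subseteq>F. joins Q' (g i) (g j) \<and> sum w Q' \<le> (1 + \<epsilon>) * sum w Q))) \<and>
    real N \<le> real k * (log 2 (real k) + 1) * (4 / \<epsilon> + 3) \<and>
    card (closed_sub (g ` {..<k}) F) \<le> 2 ^ (N * (2 * N + k))"
proof -
  define lo where "lo i s = i div 2 ^ Suc s * 2 ^ Suc s" for i s :: nat
  define mid where "mid i s = lo i s + 2 ^ s" for i s
  \<comment> \<open>A midpoint beyond the last gap separates no two gaps. As
    \<open>2 ^ s \<le> mid i s < k\<close>, at most \<open>log 2 k + 1\<close> scales
    remain.\<close>
  define J where "J = {(i, s). i < k \<and> mid i s < k}"
  have lo_le: "lo i s \<le> i" for i s unfolding lo_def by (rule div_times_less_eq_dividend)
  have JX: "g i \<in> X" "g (lo i s) \<in> X" "g (mid i s) \<in> X" if "(i, s) \<in> J" for i s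
    using that gX lo_le[of i s] unfolding J_def by auto
  have Jsub: "J \<subseteq> {..<k} \<times> {s. 2 ^ s < k}" unfolding J_def mid_def by auto
  have finJ: "finite J" using finite_subset[OF Jsub] card_powers_below(1)[OF k] by simp
  have "card J \<le> k * card {s. 2 ^ s < k}"
    using card_mono[OF _ Jsub] card_powers_below(1)[OF k] by (simp add: card_cartesian_product)
  then have "real (card J) \<le> real k * real (card {s. 2 ^ s < k})" by (metis of_nat_le_iff of_nat_mult)
  also have "\<dots> \<le> real k * (log 2 (real k) + 1)" using card_powers_below(2)[OF k] by (intro mult_left_mono) auto
  finally have cJ: "real (card J) \<le> real k * (log 2 (real k) + 1)" .
  define sep where "sep p = (case p of (i, s) \<Rightarrow> path (g (lo i s)) (g (mid i s)))" for p
  have "\<forall>p\<in>J. \<exists>R. (case p of (i, s) \<Rightarrow> R \<subseteq> seg (g (lo i s)) (g (mid i s)) \<and> real (card R) \<le> 4 / \<epsilon> + 2 \<and>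
    (\<forall>q\<in>seg (g (lo i s)) (g (mid i s)). \<exists>p\<in>R. gd (g i) p + gd p q \<le> (1 + \<epsilon>) * gd (g i) q))"
    using geodesic_portals[OF _ _ _ eps] JX by (auto simp del: Un_iff)
  then obtain R where "\<forall>p\<in>J. (case p of (i, s) \<Rightarrow> R p \<subseteq> seg (g (lo i s)) (g (mid i s)) \<and> real (card (R p)) \<le> 4 / \<epsilon> + 2 \<and>
    (\<forall>q\<in>seg (g (lo i s)) (g (mid i s)). \<exists>p\<in>R p. gd (g i) p + gd p q \<le> (1 + \<epsilon>) * gd (g i) q))"
    by (rule bchoice[elim_format]) blast
  then have R: "R (i, s) \<subseteq> seg (g (lo i s)) (g (mid i s))" "real (card (R (i, s))) \<le> 4 / \<epsilon> + 2"
    "\<And>q. q \<in> seg (g (lo i s)) (g (mid i s)) \<Longrightarrow> \<exists>p\<in>R (i, s). gd (g i) p + gd p q \<le> (1 + \<epsilon>) * gd (g i) q"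
    if "(i, s) \<in> J" for i s using that by auto
  have finR: "finite (R (i, s))" if "(i, s) \<in> J" for i s
    using finite_subset[OF R(1) finite_seg] JX that by blast
  define \<P> where "\<P> = sep ` J \<union> (\<Union>p\<in>J. path (g (fst p)) ` R p)"
  define F where "F = \<Union>\<P>"
  have \<P>: "\<exists>x\<in>X. \<exists>y\<in>X. P = path x y" if P: "P \<in> \<P>" for P
  proof -
    consider i s where "(i, s) \<in> J" "P = path (g (lo i s)) (g (mid i s))"
      | i s p where "(i, s) \<in> J" "p \<in> R (i, s)" "P = path (g i) p"
      using P unfolding \<P>_def sep_def by auto
    then show ?thesis
    proof cases
      case 1
      then show ?thesis using JX by blast
    next
      case 2
      then show ?thesis using JX R(1) seg_in by blast
    qed
  qed
  have fin\<P>: "finite \<P>" unfolding \<P>_def using finJ finR by auto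
  have FE: "F \<subseteq> E" unfolding F_def using \<P> path_subset by blast
  \<comment> \<open>Each pair in \<open>J\<close> accounts for one separator and at most
    \<open>4 / \<epsilon> + 2\<close> portal paths.\<close>
  have card\<P>: "real (card \<P>) \<le> real k * (log 2 (real k) + 1) * (4 / \<epsilon> + 3)"
  proof -
    have "card \<P> \<le> card (sep ` J) + card (\<Union>p\<in>J. path (g (fst p)) ` R p)"
      unfolding \<P>_def by (rule card_Un_le)
    also have "\<dots> \<le> card J + (\<Sum>p\<in>J. card (path (g (fst p)) ` R p))"
      using finJ by (intro add_mono card_image_le card_UN_le)
    also have "\<dots> \<le> card J + (\<Sum>p\<in>J. card (R p))"
      using finR by (intro add_left_mono Groups_Big.sum_mono card_image_le) auto
    finally have "real (card \<P>) \<le> real (card J) + (\<Sum>p\<in>J. real (card (R p)))"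
      by (metis of_nat_add of_nat_le_iff of_nat_sum)
    also have "(\<Sum>p\<in>J. real (card (R p))) \<le> real (card J) * (4 / \<epsilon> + 2)"
      using R(2) by (intro sum_bounded_above) auto
    also have "real (card J) + real (card J) * (4 / \<epsilon> + 2) = real (card J) * (4 / \<epsilon> + 3)"
      by (simp add: algebra_simps)
    also have "\<dots> \<le> real k * (log 2 (real k) + 1) * (4 / \<epsilon> + 3)"
      using cJ eps by (intro mult_right_mono) auto
    finally show ?thesis by simp
  qed
  have "card (closed_sub (g ` {..<k}) F) \<le> 2 ^ (card \<P> * (2 * card \<P> + card (g ` {..<k})))"
    unfolding F_def using fin\<P> \<P> by (intro card_closed_sub_Union_paths) auto
  also have "\<dots> \<le> 2 ^ (card \<P> * (2 * card \<P> + k))"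
    using card_image_le[of "{..<k}" g] by (intro power_increasing mult_left_mono) auto
  finally have closed: "card (closed_sub (g ` {..<k}) F) \<le> 2 ^ (card \<P> * (2 * card \<P> + k))" .
  have detour: "\<exists>D\<subseteq>F. joins D (g i) q \<and> sum w D \<le> (1 + \<epsilon>) * gd (g i) q"
    if J: "(i, s) \<in> J" and q: "q \<in> seg (g (lo i s)) (g (mid i s))" for i s q
  proof -
    obtain p where p: "p \<in> R (i, s)" "gd (g i) p + gd p q \<le> (1 + \<epsilon>) * gd (g i) q"
      using R(3)[OF J q] by blast
    have pseg: "p \<in> seg (g (lo i s)) (g (mid i s))" using R(1)[OF J] p(1) by blast
    have X: "g i \<in> X" "p \<in> X" "q \<in> X" using JX J seg_in pseg q by auto
    have "path (g i) p \<subseteq> F" unfolding F_def \<P>_def using J p(1) by force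
    \<comment> \<open>After the portal the detour follows the separator, which is part of
      \<open>F\<close>.\<close>
    moreover have "path p q \<subseteq> sep (i, s)"
      unfolding sep_def using path_between_subset[OF _ _ pseg q] JX J by simp
    then have "path p q \<subseteq> F" unfolding F_def \<P>_def using J by blast
    moreover have "sum w (path (g i) p \<triangle> path p q) \<le> gd (g i) p + gd p q"
      unfolding gd_def using X by (intro sum_sym_diff_le path_subset)
    ultimately show ?thesis
      using joins_path_concat[OF X] p(2) by (intro exI[of _ "path (g i) p \<triangle> path p q"]) auto
  qed
  have forward: "\<exists>Q'\<subseteq>F. joins Q' (g i) (g j) \<and> sum w Q' \<le> (1 + \<epsilon>) * sum w Q"
    if ij: "i < j" "j < k" and Q: "Q \<subseteq> E" "joins Q (g i) (g j)" for i j Q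
  proof -
    obtain s a where s: "a = lo i s" "a = lo j s" "a \<le> i" "i < a + 2 ^ s" "a + 2 ^ s \<le> j"
      using dyadic_separation[OF ij(1)] unfolding lo_def by metis
    have "lo i s + 2 ^ s < k" "lo j s + 2 ^ s < k" using s(1,2,5) ij(2) by linarith+
    then have J: "(i, s) \<in> J" "(j, s) \<in> J" unfolding J_def mid_def using ij by simp_all
    have X: "g i \<in> X" "g j \<in> X" "g a \<in> X" "g (a + 2 ^ s) \<in> X"
      using gX[of i] gX[of j] gX[of a] gX[of "a + 2 ^ s"] s(3-5) ij by simp_all
    have "verts (path (g a) (g (a + 2 ^ s))) \<inter> verts (path (g i) (g j)) \<noteq> {}"
      using cross[OF s(3,4,5) ij(2) path_subset[OF X(3,4)] joins_path[OF X(3,4)]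
        path_subset[OF X(1,2)] joins_path[OF X(1,2)]] .
    then obtain q where "q \<in> verts (path (g a) (g (a + 2 ^ s)))" "q \<in> verts (path (g i) (g j))" by blast
    then have q: "q \<in> seg (g a) (g (a + 2 ^ s))" "q \<in> seg (g i) (g j)"
      using verts_path_subset_seg X by blast+
    have qX: "q \<in> X" using q seg_in by blast
    \<comment> \<open>\<open>i\<close> and \<open>j\<close> lie in the same block, so one separator
      serves the detours from both.\<close>
    have mid: "mid i s = a + 2 ^ s" "mid j s = a + 2 ^ s" unfolding mid_def using s by auto
    obtain D where D: "D \<subseteq> F" "joins D (g i) q" "sum w D \<le> (1 + \<epsilon>) * gd (g i) q"
      using detour[OF J(1), of q] q(1) mid s(1) by auto
    obtain D' where D': "D' \<subseteq> F" "joins D' (g j) q" "sum w D' \<le> (1 + \<epsilon>) * gd (g j) q"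
      using detour[OF J(2), of q] q(1) mid s(2) by auto
    have DE: "D \<subseteq> E" "D' \<subseteq> E" using D(1) D'(1) FE by auto
    have "sum w (D \<triangle> D') \<le> sum w D + sum w D'" using sum_sym_diff_le[OF DE] .
    also have "\<dots> \<le> (1 + \<epsilon>) * (gd (g i) q + gd q (g j))"
      using D(3) D'(3) gd_sym[OF X(2) qX] by (simp add: algebra_simps)
    also have "\<dots> = (1 + \<epsilon>) * gd (g i) (g j)" using q(2) by (simp add: seg_def)
    also have "\<dots> \<le> (1 + \<epsilon>) * sum w Q" using gd_le[OF X(1,2) Q] eps by (intro mult_left_mono) auto
    finally have "sum w (D \<triangle> D') \<le> (1 + \<epsilon>) * sum w Q" .
    moreover have "joins (D \<triangle> D') (g i) (g j)"
      using joins_trans[OF _ _ D(2) joins_sym[OF D'(2)]] fin_sub DE by blast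
    ultimately show ?thesis using D(1) D'(1) by (intro exI[of _ "D \<triangle> D'"]) auto
  qed
  have "\<exists>Q'\<subseteq>F. joins Q' (g i) (g j) \<and> sum w Q' \<le> (1 + \<epsilon>) * sum w Q"
    if ij: "i < k" "j < k" "i \<noteq> j" and Q: "Q \<subseteq> E" "joins Q (g i) (g j)" for i j Q
  proof (cases "i < j")
    case True
    then show ?thesis using forward[OF True ij(2) Q] by blast
  next
    case False
    then have "j < i" using ij by simp
    then obtain Q' where "Q' \<subseteq> F" "joins Q' (g j) (g i)" "sum w Q' \<le> (1 + \<epsilon>) * sum w Q"
      using forward[OF _ ij(1) Q(1) joins_sym[OF Q(2)]] by blast
    then show ?thesis using joins_sym[of Q'] by blast
  qed
  then show ?thesis using FE card\<P> closed by (intro exI[of _ F] exI[of _ "card \<P>"]) blast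
qed

end

section \<open>Contraction along a family of cuts\<close>

text \<open>Edges get their weights one at a time. Two edge sets that disagree about
  \<open>e\<close> tie for a single value of the weight of \<open>e\<close>, so only finitely many
  values are bad, and the admissible interval is infinite.\<close>

lemma generic_weights:
  fixes c :: "'e \<Rightarrow> real"
  assumes "finite E" "\<And>e. e \<in> E \<Longrightarrow> 0 < c e" "0 < \<eta>"
  shows "\<exists>w. (\<forall>e\<in>E. c e \<le> w e \<and> w e \<le> (1 + \<eta>) * c e) \<and> inj_on (sum w) (Pow E)"
  using assms(1,2)
proof (induction E rule: finite_induct)
  case (insert e E)
  obtain w where w: "\<forall>e\<in>E. c e \<le> w e \<and> w e \<le> (1 + \<eta>) * c e" "inj_on (sum w) (Pow E)"
    using insert.IH insert.prems by auto
  define bad where "bad = (\<lambda>(A, B). sum w A - sum w B) ` (Pow E \<times> Pow E)"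
  have "finite bad" unfolding bad_def using insert.hyps by simp
  moreover have "c e < (1 + \<eta>) * c e" using insert.prems[of e] assms(3) by simp
  then have "infinite {c e..(1 + \<eta>) * c e}" by (rule infinite_Icc)
  ultimately obtain x where x: "x \<in> {c e..(1 + \<eta>) * c e}" "x \<notin> bad"
    by (meson finite_subset subsetI)
  define w' where "w' = w(e := x)"
  have sum': "sum w' A = sum w (A - {e}) + (if e \<in> A then x else 0)" if "A \<subseteq> insert e E" for A
  proof -
    have fin: "finite A" using that insert.hyps finite_subset by blast
    have "sum w' (A - {e}) = sum w (A - {e})" by (rule sum.cong) (auto simp: w'_def)
    moreover have "sum w' A = (if e \<in> A then w' e else 0) + sum w' (A - {e})"
      using sum.remove[OF fin, of e w'] by simp
    ultimately show ?thesis by (simp add: w'_def)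
  qed
  have diff: "sum w (A - {e}) - sum w (B - {e}) \<noteq> x" if "A \<subseteq> insert e E" "B \<subseteq> insert e E" for A B
  proof
    assume "sum w (A - {e}) - sum w (B - {e}) = x"
    moreover have "(A - {e}, B - {e}) \<in> Pow E \<times> Pow E" using that by auto
    ultimately have "x \<in> bad" unfolding bad_def by (force intro: image_eqI[where x = "(A - {e}, B - {e})"])
    then show False using x by simp
  qed
  have "inj_on (sum w') (Pow (insert e E))"
  proof (rule inj_onI)
    fix A B assume AB: "A \<in> Pow (insert e E)" "B \<in> Pow (insert e E)" and eq: "sum w' A = sum w' B"
    have sub: "A \<subseteq> insert e E" "B \<subseteq> insert e E" using AB by auto
    have iff: "e \<in> A \<longleftrightarrow> e \<in> B"
      using eq diff[OF sub] diff[OF sub(2,1)] sum'[OF sub(1)] sum'[OF sub(2)] by (auto split: if_splits)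
    then have "sum w (A - {e}) = sum w (B - {e})" using eq sum'[OF sub(1)] sum'[OF sub(2)] by simp
    moreover have "A - {e} \<in> Pow E" "B - {e} \<in> Pow E" using sub by auto
    ultimately have "A - {e} = B - {e}" using w(2) by (meson inj_onD)
    then show "A = B" using iff by blast
  qed
  moreover have "\<forall>e'\<in>insert e E. c e' \<le> w' e' \<and> w' e' \<le> (1 + \<eta>) * c e'"
    using w(1) x(1) unfolding w'_def by auto
  ultimately show ?case by blast
qed simp

section \<open>Cuts of a network and contraction\<close>

definition cutset :: "nat set set \<Rightarrow> nat set \<Rightarrow> nat set set" where
  "cutset E W = {e \<in> E. card (e \<inter> W) = 1}"

lemma cut_weight_cutset: "cut_weight E c W = sum c (cutset E W)"
  unfolding cut_weight_def cutset_def ..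

lemma card_pair_Int:
  assumes "u \<noteq> v"
  shows "card ({u, v} \<inter> W) = 1 \<longleftrightarrow> (u \<in> W) \<noteq> (v \<in> W)"
  using assms by (cases "u \<in> W"; cases "v \<in> W") simp_all

locale network =
  fixes V :: "nat set" and E :: "nat set set" and T :: "nat set" and c :: "nat set \<Rightarrow> real"
  assumes net: "is_network V E T c"
begin

lemma edgeE:
  assumes "e \<in> E"
  obtains u v where "e = {u, v}" "u \<in> V" "v \<in> V" "u \<noteq> v"
  using net assms unfolding is_network_def by blast

lemma edge_in:
  assumes "{u, v} \<in> E"
  shows "u \<in> V" "v \<in> V" "u \<noteq> v"
  using edgeE[OF assms] by (metis doubleton_eq_iff)+

lemma finite_V: "finite V" and finite_E: "finite E"
proof -
  show "finite V" using net unfolding is_network_def by simp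
  moreover have "E \<subseteq> Pow V" using edgeE by blast
  ultimately show "finite E" using finite_subset by blast
qed

lemma connected_V: "u \<in> V \<Longrightarrow> v \<in> V \<Longrightarrow> (u, v) \<in> {(x, y). {x, y} \<in> E}\<^sup>*"
  using net unfolding is_network_def by blast

lemma T_subset_V: "T \<subseteq> V"
  using net unfolding is_network_def by blast

lemma cutset_pair: "{u, v} \<in> E \<Longrightarrow> {u, v} \<in> cutset E W \<longleftrightarrow> (u \<in> W) \<noteq> (v \<in> W)"
  using card_pair_Int[OF edge_in(3)] unfolding cutset_def by simp

text \<open>Connectivity propagates the side of \<open>v0\<close>. Hence a connected graph on n
  vertices has \<open>2 ^ (n - 1)\<close> cuts, a count used both for the size of the minor and for
  the duality.\<close>

lemma cutset_determines:
  assumes "cutset E W = cutset E W'" "W \<subseteq> V" "W' \<subseteq> V" "v0 \<in> V" "v0 \<notin> W" "v0 \<notin> W'"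
  shows "W = W'"
proof -
  have "v \<in> W \<longleftrightarrow> v \<in> W'" if "v \<in> V" for v
    using connected_V[OF assms(4) that]
  proof (induction rule: rtrancl_induct)
    case (step y z)
    then have "{y, z} \<in> E" by simp
    then show ?case using cutset_pair[of y z W] cutset_pair[of y z W'] assms(1) step.IH by auto
  qed (use assms in simp)
  then show ?thesis using assms by blast
qed

lemma
  shows mincut_le: "W \<subseteq> V \<Longrightarrow> W \<inter> T = S \<or> W \<inter> T = T - S \<Longrightarrow> mincut V E T c S \<le> cut_weight E c W"
    and mincut_attained: "S \<subseteq> T \<Longrightarrow> \<exists>W\<subseteq>V. (W \<inter> T = S \<or> W \<inter> T = T - S) \<and> mincut V E T c S = cut_weight E c W"
proof -
  let ?M = "{cut_weight E c W | W. W \<subseteq> V \<and> (W \<inter> T = S \<or> W \<inter> T = T - S)}"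
  have "?M \<subseteq> cut_weight E c ` Pow V" by blast
  then have fin: "finite ?M" using finite_V finite_subset by blast
  show "mincut V E T c S \<le> cut_weight E c W" if "W \<subseteq> V" "W \<inter> T = S \<or> W \<inter> T = T - S"
  proof -
    have "cut_weight E c W \<in> ?M" using that unfolding mem_Collect_eq by (intro exI[of _ W]) simp
    then show ?thesis unfolding mincut_def by (rule Min_le[OF fin])
  qed
  assume S: "S \<subseteq> T"
  have "S \<subseteq> V \<and> (S \<inter> T = S \<or> S \<inter> T = T - S)" using S T_subset_V by blast
  then have "?M \<noteq> {}" by blast
  then have "mincut V E T c S \<in> ?M" unfolding mincut_def by (rule Min_in[OF fin])
  then show "\<exists>W\<subseteq>V. (W \<inter> T = S \<or> W \<inter> T = T - S) \<and> mincut V E T c S = cut_weight E c W" by blast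
qed

text \<open>The components left by \<open>F\<close> become vertices and parallel edges are merged
  with added weights, so a cut of the quotient weighs exactly as much as its preimage. By
  \<open>sep\<close> a component can be named after its only terminal.\<close>

lemma contraction:
  assumes F: "F \<subseteq> E"
    and sep: "\<And>t t'. t \<in> T \<Longrightarrow> t' \<in> T \<Longrightarrow> (t, t') \<in> {(x, y). {x, y} \<in> E - F}\<^sup>* \<Longrightarrow> t = t'"
  shows "\<exists>nm EH cH. is_network (nm ` V) EH T cH \<and> is_terminal_minor (nm ` V) EH V E T \<and>
    (\<forall>t\<in>T. nm t = t) \<and> (\<forall>u v. {u, v} \<in> E - F \<longrightarrow> nm u = nm v) \<and>
    (\<forall>u v. nm u = nm v \<longrightarrow> (u, v) \<in> {(x, y). {x, y} \<in> E - F}\<^sup>*) \<and>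
    (\<forall>Y. cut_weight EH cH Y = cut_weight E c {v \<in> V. nm v \<in> Y})"
proof -
  let ?r = "{(x, y). {x, y} \<in> E - F}"
  let ?R = "?r\<^sup>*"
  have "sym ?r" by (auto intro!: symI simp: insert_commute)
  then have sym: "sym ?R" by (rule sym_rtrancl)
  have R_sym: "(v, u) \<in> ?R" if "(u, v) \<in> ?R" for u v using symD[OF sym that] .
  \<comment> \<open>Terminals are preferred as representatives, so that they keep their names. The
    predicate depends only on the component of \<open>v\<close>, and hence so does the
    choice.\<close>
  define ok where "ok v u \<longleftrightarrow> (v, u) \<in> ?R \<and> ((\<exists>t\<in>T. (v, t) \<in> ?R) \<longrightarrow> u \<in> T)" for v u
  define nm where "nm v = (SOME u. ok v u)" for v
  have ok: "ok v (nm v)" for v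
  proof -
    have "\<exists>u. ok v u" unfolding ok_def by (cases "\<exists>t\<in>T. (v, t) \<in> ?R") blast+
    then show ?thesis unfolding nm_def by (rule someI_ex)
  qed
  have nm_eq: "nm u = nm v" if uv: "(u, v) \<in> ?R" for u v
  proof -
    have "(u, x) \<in> ?R \<longleftrightarrow> (v, x) \<in> ?R" for x
      using uv R_sym[OF uv] rtrancl_trans[of _ _ ?r] by blast
    then have "ok u = ok v" unfolding ok_def by (intro ext) simp
    then show ?thesis unfolding nm_def by simp
  qed
  have nm_R: "(v, nm v) \<in> ?R" for v using ok[of v] unfolding ok_def by simp
  have nm_eqD: "(u, v) \<in> ?R" if "nm u = nm v" for u v
    using rtrancl_trans[OF nm_R[of u]] R_sym[OF nm_R[of v]] that by simp
  have nm_T: "nm t = t" if t: "t \<in> T" for t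
  proof -
    have "nm t \<in> T" using ok[of t] t unfolding ok_def by blast
    then show ?thesis using sep[OF t _ nm_R[of t]] by simp
  qed
  define EH where "EH = {{nm u, nm v} | u v. {u, v} \<in> E \<and> nm u \<noteq> nm v}"
  define cH where "cH e' = sum c {e \<in> E. nm ` e = e'}" for e'
  have imE: "nm ` e \<in> EH \<longleftrightarrow> nm u \<noteq> nm v" if e: "e \<in> E" "e = {u, v}" for e u v
  proof
    assume "nm ` e \<in> EH"
    then obtain a b where "{nm u, nm v} = {nm a, nm b}" "nm a \<noteq> nm b" using e(2) unfolding EH_def by auto
    then show "nm u \<noteq> nm v" by (metis doubleton_eq_iff)
  qed (use e EH_def in auto)
  have EH_sub: "EH \<subseteq> {{u, v} | u v. u \<in> nm ` V \<and> v \<in> nm ` V \<and> u \<noteq> v}"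
    unfolding EH_def using edge_in(1,2) by blast
  have cHpos: "0 < cH e'" if e': "e' \<in> EH" for e'
  proof -
    obtain u v where "e' = {nm u, nm v}" "{u, v} \<in> E" using e' unfolding EH_def by blast
    then have "{u, v} \<in> {e \<in> E. nm ` e = e'}" by simp
    then have "{e \<in> E. nm ` e = e'} \<noteq> {}" by blast
    then show ?thesis unfolding cH_def using finite_E net unfolding is_network_def by (intro sum_pos) auto
  qed
  have conn: "(nm u, nm v) \<in> {(x, y). {x, y} \<in> EH}\<^sup>*" if "(u, v) \<in> {(x, y). {x, y} \<in> E}\<^sup>*" for u v
    using that
  proof (induction rule: rtrancl_induct)
    case (step y z)
    then have "nm y = nm z \<or> {nm y, nm z} \<in> EH" unfolding EH_def by blast
    then show ?case using step.IH by (auto intro: rtrancl_into_rtrancl)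
  qed simp
  have "is_network (nm ` V) EH T cH"
    unfolding is_network_def
  proof (intro conjI)
    show "T \<subseteq> nm ` V"
    proof
      fix t assume "t \<in> T"
      then show "t \<in> nm ` V" using nm_T[of t] T_subset_V by (intro image_eqI[of _ _ t]) auto
    qed
    show "nm ` V \<noteq> {}" using net unfolding is_network_def by simp
    show "\<forall>u\<in>nm ` V. \<forall>v\<in>nm ` V. (u, v) \<in> {(x, y). {x, y} \<in> EH}\<^sup>*"
      using conn connected_V by blast
  qed (use finite_V EH_sub cHpos in auto)
  moreover have "is_terminal_minor (nm ` V) EH V E T"
    unfolding is_terminal_minor_def
  proof (intro exI[of _ "\<lambda>x. {v \<in> V. nm v = x}"] conjI ballI impI)
    fix x u w assume uw: "u \<in> {v \<in> V. nm v = x}" "w \<in> {v \<in> V. nm v = x}"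
    then have "(u, w) \<in> ?R" using nm_eqD by simp
    then show "(u, w) \<in> {(p, q). {p, q} \<in> E \<and> p \<in> {v \<in> V. nm v = x} \<and> q \<in> {v \<in> V. nm v = x}}\<^sup>*"
    proof (induction rule: rtrancl_induct)
      case (step y z)
      have "{y, z} \<in> E" using step.hyps(2) by simp
      moreover have "nm y = x" "nm z = x"
        using nm_eq[OF step.hyps(1)] nm_eq[OF rtrancl_into_rtrancl[OF step.hyps]] uw(1) by simp_all
      ultimately show ?case using step.IH edge_in[of y z] by (intro rtrancl_into_rtrancl[OF step.IH]) simp
    qed simp
  next
    fix x y assume xy: "x \<in> nm ` V" "y \<in> nm ` V" "{x, y} \<in> EH"
    then obtain u v where uv: "{x, y} = {nm u, nm v}" "{u, v} \<in> E" unfolding EH_def by blast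
    have V: "u \<in> V" "v \<in> V" using edge_in uv(2) by blast+
    have "{v, u} \<in> E" using uv(2) by (simp add: insert_commute)
    then show "\<exists>u\<in>{v \<in> V. nm v = x}. \<exists>w\<in>{v \<in> V. nm v = y}. {u, w} \<in> E"
      using uv V unfolding doubleton_eq_iff by blast
  next
    fix t assume t: "t \<in> T"
    then have tV: "t \<in> V" "nm t = t" using nm_T T_subset_V by blast+
    then show "t \<in> {v \<in> V. nm v = t}" by simp
    show "t \<in> nm ` V" using imageI[OF tV(1), of nm] tV(2) by simp
  qed auto
  moreover have "cut_weight EH cH Y = cut_weight E c {v \<in> V. nm v \<in> Y}" for Y
  proof -
    let ?W = "{v \<in> V. nm v \<in> Y}"
    have iff: "e \<in> cutset E ?W \<longleftrightarrow> nm ` e \<in> cutset EH Y" if eE: "e \<in> E" for e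
    proof -
      obtain u v where e: "e = {u, v}" "u \<in> V" "v \<in> V" using edgeE[OF eE] by metis
      have im: "nm ` e = {nm u, nm v}" using e by simp
      have "e \<in> cutset E ?W \<longleftrightarrow> (nm u \<in> Y) \<noteq> (nm v \<in> Y)"
        using cutset_pair[of u v ?W] eE e by simp
      also have "\<dots> \<longleftrightarrow> nm u \<noteq> nm v \<and> card ({nm u, nm v} \<inter> Y) = 1"
        using card_pair_Int[of "nm u" "nm v" Y] by auto
      finally show ?thesis using imE[OF eE e(1)] im unfolding cutset_def by simp
    qed
    have fin: "finite (cutset E ?W)" "finite (cutset EH Y)"
    proof -
      have "EH \<subseteq> Pow (nm ` V)" using EH_sub by blast
      then have "finite EH" using finite_V finite_subset by blast
      then show "finite (cutset E ?W)" "finite (cutset EH Y)" unfolding cutset_def using finite_E by simp_all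
    qed
    have "(\<Sum>e'\<in>cutset EH Y. sum c {e \<in> cutset E ?W. nm ` e = e'}) = sum c (cutset E ?W)"
      using iff by (intro sum.group fin) (auto simp: cutset_def)
    moreover have "{e \<in> cutset E ?W. nm ` e = e'} = {e \<in> E. nm ` e = e'}" if "e' \<in> cutset EH Y" for e'
      using iff that unfolding cutset_def by blast
    ultimately show ?thesis unfolding cut_weight_cutset cH_def by simp
  qed
  moreover have "\<forall>u v. {u, v} \<in> E - F \<longrightarrow> nm u = nm v" using nm_eq by blast
  ultimately show ?thesis using nm_T nm_eqD by (intro exI[of _ nm] exI[of _ EH] exI[of _ cH]) blast
qed

text \<open>Cuts of the minor pull back with equal weight, which gives the lower bound. A cut inside
  \<open>F\<close> splits no component and so descends to the minor, which gives the upper bound.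
  For the size, the vertex sets of the minor that avoid one fixed vertex pull back to distinct cuts
  inside \<open>F\<close>.\<close>

lemma sparsifier_from_cut_family:
  assumes F: "F \<subseteq> E"
    and approx: "\<forall>W\<subseteq>V. \<exists>W'\<subseteq>V. (W' \<inter> T = W \<inter> T \<or> W' \<inter> T = T - W) \<and> cutset E W' \<subseteq> F \<and>
        cut_weight E c W' \<le> q * cut_weight E c W"
  shows "\<exists>VH EH cH. is_network VH EH T cH \<and> is_terminal_minor VH EH V E T \<and>
    2 ^ (card VH - 1) \<le> card {D. D \<subseteq> F \<and> (\<exists>W\<subseteq>V. D = cutset E W)} \<and>
    (\<forall>S\<subseteq>T. mincut V E T c S \<le> mincut VH EH T cH S \<and> mincut VH EH T cH S \<le> q * mincut V E T c S)"
proof -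
  have same_side: "x \<in> W \<longleftrightarrow> y \<in> W" if "(x, y) \<in> {(x, y). {x, y} \<in> E - F}\<^sup>*" "cutset E W \<subseteq> F" for x y W
    using that(1)
  proof (induction rule: rtrancl_induct)
    case (step y z)
    then have "{y, z} \<in> E" "{y, z} \<notin> cutset E W" using that(2) by auto
    then show ?case using cutset_pair step.IH by blast
  qed simp
  \<comment> \<open>The cut that approximates \<open>{t}\<close> lies in \<open>F\<close> and
    separates \<open>t\<close> from every other terminal.\<close>
  have sep: "t = t'" if t: "t \<in> T" "t' \<in> T" "(t, t') \<in> {(x, y). {x, y} \<in> E - F}\<^sup>*" for t t'
  proof (rule ccontr)
    assume "t \<noteq> t'"
    have "{t} \<inter> T = {t}" "{t} \<subseteq> V" using t T_subset_V by auto
    then obtain W' where W': "W' \<inter> T = {t} \<or> W' \<inter> T = T - {t}" "cutset E W' \<subseteq> F"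
      using approx[rule_format, of "{t}"] by metis
    have "t \<in> W' \<longleftrightarrow> t' \<notin> W'" using W'(1) t(1,2) \<open>t \<noteq> t'\<close> by (metis Diff_iff Int_iff singletonD singletonI)
    then show False using same_side[OF t(3) W'(2)] by blast
  qed
  obtain nm EH cH where H: "is_network (nm ` V) EH T cH" "is_terminal_minor (nm ` V) EH V E T"
    and nm_T: "\<And>t. t \<in> T \<Longrightarrow> nm t = t"
    and nm_edge: "\<And>u v. {u, v} \<in> E - F \<Longrightarrow> nm u = nm v"
    and nm_eqD: "\<And>u v. nm u = nm v \<Longrightarrow> (u, v) \<in> {(x, y). {x, y} \<in> E - F}\<^sup>*"
    and cut: "\<And>Y. cut_weight EH cH Y = cut_weight E c {v \<in> V. nm v \<in> Y}"
    using contraction[OF F sep] by blast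
  interpret H: network "nm ` V" EH T cH by (rule network.intro[OF H(1)])
  let ?VH = "nm ` V"
  let ?pre = "\<lambda>Y. {v \<in> V. nm v \<in> Y}"
  have finVH: "finite ?VH" using finite_V by simp
  obtain v0 where v0: "v0 \<in> V" using net unfolding is_network_def by blast
  have "2 ^ (card ?VH - 1) = card (Pow (?VH - {nm v0}))"
    using v0 finVH by (simp add: card_Pow card_Diff_singleton)
  also have "\<dots> \<le> card {D. D \<subseteq> F \<and> (\<exists>W\<subseteq>V. D = cutset E W)}"
  proof (rule card_inj_on_le)
    show "inj_on (\<lambda>Y. cutset E (?pre Y)) (Pow (?VH - {nm v0}))"
    proof (rule inj_onI)
      fix Y Y' assume Y: "Y \<in> Pow (?VH - {nm v0})" "Y' \<in> Pow (?VH - {nm v0})"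
        "cutset E (?pre Y) = cutset E (?pre Y')"
      have "?pre Y = ?pre Y'" using Y v0 by (intro cutset_determines[OF Y(3) _ _ v0]) auto
      moreover have "Y = nm ` ?pre Y" "Y' = nm ` ?pre Y'" using Y by auto
      ultimately show "Y = Y'" by simp
    qed
    show "(\<lambda>Y. cutset E (?pre Y)) ` Pow (?VH - {nm v0}) \<subseteq> {D. D \<subseteq> F \<and> (\<exists>W\<subseteq>V. D = cutset E W)}"
    proof (rule image_subsetI)
      fix Y
      have "e \<in> F" if e: "e \<in> cutset E (?pre Y)" for e
      proof (rule ccontr)
        assume "e \<notin> F"
        have "e \<in> E" using e unfolding cutset_def by simp
        then obtain u v where uv: "e = {u, v}" "u \<in> V" "v \<in> V" using edgeE by metis
        then have "nm u = nm v" using nm_edge \<open>e \<in> E\<close> \<open>e \<notin> F\<close> by simp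
        then show False using cutset_pair[of u v "?pre Y"] e uv \<open>e \<in> E\<close> by simp
      qed
      then have "cutset E (?pre Y) \<subseteq> F" by (rule subsetI)
      moreover have "?pre Y \<subseteq> V" by simp
      ultimately show "cutset E (?pre Y) \<in> {D. D \<subseteq> F \<and> (\<exists>W\<subseteq>V. D = cutset E W)}"
        unfolding mem_Collect_eq by (intro conjI exI[of _ "?pre Y"] refl)
    qed
    have "{D. D \<subseteq> F \<and> (\<exists>W\<subseteq>V. D = cutset E W)} \<subseteq> Pow E" using F by blast
    then show "finite {D. D \<subseteq> F \<and> (\<exists>W\<subseteq>V. D = cutset E W)}"
      using finite_E finite_subset by blast
  qed
  finally have count: "2 ^ (card ?VH - 1) \<le> card {D. D \<subseteq> F \<and> (\<exists>W\<subseteq>V. D = cutset E W)}" .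
  have lower: "mincut V E T c S \<le> mincut ?VH EH T cH S" if S: "S \<subseteq> T" for S
  proof -
    obtain Y where Y: "Y \<subseteq> ?VH" "Y \<inter> T = S \<or> Y \<inter> T = T - S" "mincut ?VH EH T cH S = cut_weight EH cH Y"
      using H.mincut_attained[OF S] by blast
    have "?pre Y \<inter> T = Y \<inter> T" using nm_T T_subset_V by auto
    then have "mincut V E T c S \<le> cut_weight E c (?pre Y)" using Y(2) by (intro mincut_le) auto
    then show ?thesis using Y(3) cut by simp
  qed
  have upper: "mincut ?VH EH T cH S \<le> q * mincut V E T c S" if S: "S \<subseteq> T" for S
  proof -
    obtain W where W: "W \<subseteq> V" "W \<inter> T = S \<or> W \<inter> T = T - S" "mincut V E T c S = cut_weight E c W"
      using mincut_attained[OF S] by blast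
    obtain W' where W': "W' \<subseteq> V" "W' \<inter> T = W \<inter> T \<or> W' \<inter> T = T - W" "cutset E W' \<subseteq> F"
      "cut_weight E c W' \<le> q * cut_weight E c W"
      using approx[rule_format, OF W(1)] by (elim exE conjE) (rule that)
    have "v \<in> W'" if "v \<in> V" "nm v \<in> nm ` W'" for v
    proof -
      obtain u where "u \<in> W'" "nm u = nm v" using \<open>nm v \<in> nm ` W'\<close> by (metis imageE)
      then show ?thesis using same_side[OF nm_eqD W'(3)] by blast
    qed
    then have pre: "?pre (nm ` W') = W'" using W'(1) by blast
    have "nm ` W' \<inter> T = ?pre (nm ` W') \<inter> T" using nm_T T_subset_V by auto
    then have "nm ` W' \<inter> T = W' \<inter> T" using pre by simp
    moreover have "T - W = T - W \<inter> T" "T - (T - S) = S" using S by blast+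
    then have "W' \<inter> T = S \<or> W' \<inter> T = T - S" using W'(2) W(2) by (elim disjE) simp_all
    ultimately have "mincut ?VH EH T cH S \<le> cut_weight EH cH (nm ` W')"
      using W'(1) by (intro H.mincut_le) auto
    then show ?thesis using cut[of "nm ` W'"] pre W'(4) W(3) by simp
  qed
  show ?thesis using H count lower upper by (intro exI[of _ ?VH] exI[of _ EH] exI[of _ cH]) blast
qed

end

section \<open>The dual with a split terminal face\<close>

lemma odd_card_changes:
  fixes P :: "nat \<Rightarrow> bool"
  assumes "a \<le> b"
  shows "odd (card {n \<in> {a..<b}. P n \<noteq> P (Suc n)}) \<longleftrightarrow> P a \<noteq> P b"
  using assms
proof (induction b rule: dec_induct)
  case (step b)
  let ?S = "{n \<in> {a..<b}. P n \<noteq> P (Suc n)}"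
  show ?case
  proof (cases "P b = P (Suc b)")
    case True
    then have "{n \<in> {a..<Suc b}. P n \<noteq> P (Suc n)} = ?S" by (auto simp: less_Suc_eq)
    then show ?thesis using step.IH True by (simp only:)
  next
    case False
    then have "{n \<in> {a..<Suc b}. P n \<noteq> P (Suc n)} = insert b ?S"
      using step.hyps(1) by (auto simp: less_Suc_eq)
    moreover have "card (insert b ?S) = Suc (card ?S)" by (intro card_insert_disjoint) simp_all
    ultimately have "odd (card {n \<in> {a..<Suc b}. P n \<noteq> P (Suc n)}) \<longleftrightarrow> even (card ?S)"
      by (simp only: even_Suc not_not)
    moreover have "even (card ?S) \<longleftrightarrow> P a = P b"
      using arg_cong[OF step.IH, of Not] by (simp only: not_not)
    moreover have "(P a = P b) \<longleftrightarrow> P a \<noteq> P (Suc b)" using False by blast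
    ultimately show ?thesis by (simp only:)
  qed
qed simp

section \<open>Faces as orbits of the face permutation\<close>

locale embedded_network = network V E T c for V E T c +
  fixes \<sigma> :: "nat \<Rightarrow> nat \<Rightarrow> nat"
  assumes rot: "rotation_system V E \<sigma>"
begin

abbreviation fp :: "nat \<times> nat \<Rightarrow> nat \<times> nat" where
  "fp \<equiv> face_perm \<sigma>"

definition orb :: "nat \<times> nat \<Rightarrow> (nat \<times> nat) set" where
  "orb d = {(fp ^^ n) d | n. True}"

definition edge :: "nat \<times> nat \<Rightarrow> nat set" where
  "edge d = {fst d, snd d}"

lemma dart_iff: "d \<in> darts E \<longleftrightarrow> edge d \<in> E"
  unfolding darts_def edge_def by (cases d) simp

lemma dart_in: "d \<in> darts E \<Longrightarrow> fst d \<in> V \<and> snd d \<in> V \<and> fst d \<noteq> snd d"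
  using edge_in dart_iff edge_def by metis

lemma finite_darts: "finite (darts E)"
proof -
  have "darts E \<subseteq> V \<times> V" using dart_in by (auto simp: mem_Times_iff)
  then show ?thesis using finite_V finite_subset by blast
qed

lemma nbrs_iff: "u \<in> nbrs E v \<longleftrightarrow> (u, v) \<in> darts E" "u \<in> nbrs E v \<longleftrightarrow> (v, u) \<in> darts E"
  unfolding nbrs_def darts_def by (simp_all add: insert_commute)

lemma rot_bij: "v \<in> V \<Longrightarrow> bij_betw (\<sigma> v) (nbrs E v) (nbrs E v)"
  and rot_trans: "v \<in> V \<Longrightarrow> u \<in> nbrs E v \<Longrightarrow> w \<in> nbrs E v \<Longrightarrow> \<exists>n. (\<sigma> v ^^ n) u = w"
  using rot unfolding rotation_system_def by blast+

lemma fp_in: "d \<in> darts E \<Longrightarrow> fp d \<in> darts E"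
  using bij_betwE[OF rot_bij, of "snd d"] dart_in[of d] nbrs_iff(1)[of "fst d" "snd d"]
    nbrs_iff(2)[of _ "snd d"]
  unfolding face_perm_def by simp

lemma fp_inj:
  assumes "d \<in> darts E" "d' \<in> darts E" "fp d = fp d'"
  shows "d = d'"
proof -
  have eq: "snd d = snd d'" "\<sigma> (snd d) (fst d) = \<sigma> (snd d) (fst d')"
    using assms(3) unfolding face_perm_def by auto
  have "fst d \<in> nbrs E (snd d)" using nbrs_iff(1)[of "fst d" "snd d"] assms(1) by simp
  moreover have "fst d' \<in> nbrs E (snd d')" using nbrs_iff(1)[of "fst d'" "snd d'"] assms(2) by simp
  then have "fst d' \<in> nbrs E (snd d)" by (simp only: eq(1))
  ultimately have "fst d = fst d'"
    using bij_betw_imp_inj_on[OF rot_bij] dart_in[OF assms(1)] eq(2) by (meson inj_onD)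
  then show ?thesis using eq(1) prod_eq_iff by blast
qed

lemma fpow_in: "d \<in> darts E \<Longrightarrow> (fp ^^ n) d \<in> darts E"
  by (induction n) (simp_all add: fp_in)

lemma fpow_inj: "d \<in> darts E \<Longrightarrow> d' \<in> darts E \<Longrightarrow> (fp ^^ n) d = (fp ^^ n) d' \<Longrightarrow> d = d'"
proof (induction n)
  case (Suc n)
  then show ?case using fp_inj[of "(fp ^^ n) d" "(fp ^^ n) d'"] fpow_in by simp
qed simp

lemma fst_fpow_Suc: "fst ((fp ^^ Suc n) d) = snd ((fp ^^ n) d)"
  unfolding face_perm_def by simp

text \<open>The length of the face's boundary walk. Vertices may recur on it, and an edge may be
  passed in both directions, but each dart occurs once.\<close>

definition period :: "nat \<times> nat \<Rightarrow> nat" where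
  "period d = (LEAST n. 0 < n \<and> (fp ^^ n) d = d)"

lemma fpow_eqD:
  assumes "d \<in> darts E" "i < j" "(fp ^^ i) d = (fp ^^ j) d"
  shows "(fp ^^ (j - i)) d = d"
proof -
  have "(fp ^^ j) d = (fp ^^ i) ((fp ^^ (j - i)) d)"
    using assms(2) by (metis comp_apply funpow_add le_add_diff_inverse less_imp_le)
  then show ?thesis using fpow_inj[of d "(fp ^^ (j - i)) d" i] assms fpow_in by simp
qed

lemma period:
  assumes d: "d \<in> darts E"
  shows "0 < period d" "(fp ^^ period d) d = d"
proof -
  have "range (\<lambda>n. (fp ^^ n) d) \<subseteq> darts E" using fpow_in[OF d] by blast
  then have "\<not> inj (\<lambda>n. (fp ^^ n) d)"
    using finite_darts finite_subset finite_imageD infinite_UNIV_nat by blast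
  then obtain i j where ij: "i \<noteq> j" "(fp ^^ i) d = (fp ^^ j) d" unfolding inj_def by blast
  have "\<exists>n. 0 < n \<and> (fp ^^ n) d = d"
  proof (cases "i < j")
    case True
    then show ?thesis using fpow_eqD[OF d True ij(2)] by (intro exI[of _ "j - i"]) simp
  next
    case False
    then have "j < i" using ij by simp
    then show ?thesis using fpow_eqD[OF d _ ij(2)[symmetric]] by (intro exI[of _ "i - j"]) simp
  qed
  then have "0 < period d \<and> (fp ^^ period d) d = d" unfolding period_def by (rule LeastI_ex)
  then show "0 < period d" "(fp ^^ period d) d = d" by simp_all
qed

lemma fpow_inj_on_period:
  assumes d: "d \<in> darts E"
  shows "inj_on (\<lambda>n. (fp ^^ n) d) {..<period d}"
proof -
  have *: False if "i < j" "j < period d" "(fp ^^ i) d = (fp ^^ j) d" for i j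
  proof -
    have "period d \<le> j - i" unfolding period_def
      using fpow_eqD[OF d that(1,3)] that(1) by (intro Least_le) simp
    then show False using that by simp
  qed
  show ?thesis
  proof (rule inj_onI)
    fix i j assume ij: "i \<in> {..<period d}" "j \<in> {..<period d}" "(fp ^^ i) d = (fp ^^ j) d"
    show "i = j" using *[of i j] *[of j i] ij by (metis lessThan_iff linorder_neqE_nat)
  qed
qed

lemma orb_period:
  assumes d: "d \<in> darts E"
  shows "orb d = (\<lambda>n. (fp ^^ n) d) ` {..<period d}"
proof -
  have "(fp ^^ n) d = (fp ^^ (n mod period d)) d" for n
    using funpow_mod_eq[OF period(2)[OF d]] by metis
  then show ?thesis unfolding orb_def using period(1)[OF d] by (auto intro!: image_eqI[of _ _ "_ mod period d"])
qed

lemma orb_self: "d \<in> orb d"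
  unfolding orb_def by (auto intro: exI[of _ 0])

lemma fp_in_orb: "fp d \<in> orb d"
  unfolding orb_def by (auto intro: exI[of _ 1])

lemma orb_eq:
  assumes d: "d \<in> darts E" and d': "d' \<in> orb d"
  shows "orb d' = orb d"
proof -
  have sub: "orb b \<subseteq> orb a" if "b \<in> orb a" for a b
  proof -
    obtain n where n: "b = (fp ^^ n) a" using \<open>b \<in> orb a\<close> unfolding orb_def by blast
    show ?thesis
    proof
      fix x assume "x \<in> orb b"
      then obtain j where "x = (fp ^^ j) b" unfolding orb_def by blast
      then have "x = (fp ^^ (j + n)) a" using n by (simp add: funpow_add)
      then show "x \<in> orb a" unfolding orb_def by blast
    qed
  qed
  obtain n where n: "n < period d" "d' = (fp ^^ n) d" using d' orb_period[OF d] by blast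
  have "(fp ^^ (period d - n)) d' = (fp ^^ (period d - n + n)) d" using n by (simp only: funpow_add comp_apply)
  then have "d = (fp ^^ (period d - n)) d'" using n period(2)[OF d] by simp
  then have "d \<in> orb d'" unfolding orb_def by blast
  then show ?thesis using sub d' by blast
qed

lemma orb_subset: "d \<in> darts E \<Longrightarrow> orb d \<subseteq> darts E"
  unfolding orb_def using fpow_in by blast

lemma faces_eq: "faces E \<sigma> = orb ` darts E"
  unfolding faces_def orb_def by blast

lemma finite_faces: "finite (faces E \<sigma>)"
  unfolding faces_eq using finite_darts by simp

lemma face_eq_orb:
  assumes "f \<in> faces E \<sigma>" "d \<in> f"
  shows "d \<in> darts E" "f = orb d"
proof -
  obtain d' where d': "d' \<in> darts E" "f = orb d'" using assms(1) unfolding faces_eq by blast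
  show "f = orb d" using orb_eq[OF d'(1)] d'(2) assms(2) by simp
  show "d \<in> darts E" using orb_subset[OF d'(1)] d'(2) assms(2) by blast
qed

lemma edge_cutset: "d \<in> darts E \<Longrightarrow> edge d \<in> cutset E W \<longleftrightarrow> (fst d \<in> W) \<noteq> (snd d \<in> W)"
  using cutset_pair[of "fst d" "snd d"] dart_iff[of d] unfolding edge_def by simp

text \<open>Each dart ends where the next one starts, so the walk changes sides exactly at cut
  edges. Within one period the darts are distinct, and counting them counts steps.\<close>

lemma odd_crossings:
  assumes d: "d \<in> darts E" and ab: "a \<le> b" "b \<le> period d"
  shows "odd (card {d' \<in> (\<lambda>n. (fp ^^ n) d) ` {a..<b}. edge d' \<in> cutset E W}) \<longleftrightarrow>
    (fst ((fp ^^ a) d) \<in> W) \<noteq> (fst ((fp ^^ b) d) \<in> W)"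
proof -
  let ?P = "\<lambda>n. fst ((fp ^^ n) d) \<in> W"
  have "edge ((fp ^^ n) d) \<in> cutset E W \<longleftrightarrow> ?P n \<noteq> ?P (Suc n)" for n
    using edge_cutset[OF fpow_in[OF d]] fst_fpow_Suc by simp
  then have "{d' \<in> (\<lambda>n. (fp ^^ n) d) ` {a..<b}. edge d' \<in> cutset E W} =
      (\<lambda>n. (fp ^^ n) d) ` {n \<in> {a..<b}. ?P n \<noteq> ?P (Suc n)}" by blast
  moreover have "inj_on (\<lambda>n. (fp ^^ n) d) {n \<in> {a..<b}. ?P n \<noteq> ?P (Suc n)}"
    using ab by (intro inj_on_subset[OF fpow_inj_on_period[OF d]]) auto
  ultimately show ?thesis using odd_card_changes[OF ab(1), of ?P] by (simp only: card_image)
qed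

end

text \<open>The face on which the terminals lie is traversed from the dart \<open>d0\<close>; \<open>nn i\<close> is the position of the
  \<open>i\<close>-th terminal in this traversal. The dual vertices are the other faces (\<open>Inr\<close>) and the \<open>k\<close> gaps
  between consecutive terminals (\<open>Inl\<close>), into which the dual vertex of the terminal face is split.\<close>

locale disc_network = embedded_network V E T c \<sigma> for V E T c \<sigma> +
  fixes d0 :: "nat \<times> nat" and nn :: "nat \<Rightarrow> nat" and k :: nat
  assumes d0: "d0 \<in> darts E"
    and k2: "2 \<le> k"
    and nn0: "nn 0 = 0"
    and nnk: "nn k = period d0"
    and nn_less: "\<And>i. i < k \<Longrightarrow> nn i < nn (Suc i)"
    and tm_bij: "bij_betw (\<lambda>i. fst ((fp ^^ nn i) d0)) {..<k} T"
    and euler: "int (card V) - int (card E) + int (card (faces E \<sigma>)) = 2"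
begin

definition tm :: "nat \<Rightarrow> nat" where
  "tm i = fst ((fp ^^ nn i) d0)"

definition pos :: "nat \<times> nat \<Rightarrow> nat" where
  "pos = the_inv_into {..<period d0} (\<lambda>n. (fp ^^ n) d0)"

definition gap :: "nat \<Rightarrow> nat" where
  "gap n = Max {i. i < k \<and> nn i \<le> n}"

text \<open>The dual vertex on the side of the dart. The two darts of an edge see its two sides, so
  their blocks are the ends of the dual edge.\<close>

definition blk :: "nat \<times> nat \<Rightarrow> nat + (nat \<times> nat) set" where
  "blk d = (if d \<in> orb d0 then Inl (gap (pos d)) else Inr (orb d))"

definition gaps :: "(nat + (nat \<times> nat) set) set" where
  "gaps = Inl ` {..<k}"

definition blocks :: "(nat + (nat \<times> nat) set) set" where
  "blocks = gaps \<union> Inr ` (faces E \<sigma> - {orb d0})"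

text \<open>\<open>Min\<close> and \<open>Max\<close> tell the two darts of an edge apart and so
  orient the dual edge.\<close>

definition lend :: "nat set \<Rightarrow> nat + (nat \<times> nat) set" where
  "lend e = blk (Min e, Max e)"

definition rend :: "nat set \<Rightarrow> nat + (nat \<times> nat) set" where
  "rend e = blk (Max e, Min e)"

sublocale dual: multigraph lend rend .

lemma tm_T: "tm ` {..<k} = T"
  using tm_bij unfolding tm_def bij_betw_def by simp

lemma tm_eq_iff: "i < k \<Longrightarrow> j < k \<Longrightarrow> tm i = tm j \<longleftrightarrow> i = j"
  using tm_bij unfolding tm_def bij_betw_def inj_on_def by auto

text \<open>The traversal closes up: the last gap ends at the first terminal.\<close>

lemma tm_k: "tm k = tm 0"
  unfolding tm_def nnk nn0 using period(2)[OF d0] by simp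

lemma nn_mono: "i \<le> j \<Longrightarrow> j \<le> k \<Longrightarrow> nn i \<le> nn j"
proof (induction j rule: dec_induct)
  case (step j)
  then show ?case using nn_less[of j] by simp
qed simp

section \<open>Darts on the sides of gaps and faces\<close>

lemma gap_iff:
  assumes n: "n < period d0" and i: "i < k"
  shows "gap n = i \<longleftrightarrow> nn i \<le> n \<and> n < nn (Suc i)"
proof -
  let ?S = "{i. i < k \<and> nn i \<le> n}"
  have fin: "finite ?S" and ne: "?S \<noteq> {}" using k2 nn0 by (auto intro: exI[of _ 0])
  have gap: "gap n \<in> ?S" unfolding gap_def using Max_in[OF fin ne] .
  show ?thesis
  proof
    assume eq: "gap n = i"
    have "n < nn (Suc i)"
    proof (rule ccontr)
      assume nle: "\<not> n < nn (Suc i)"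
      then have "Suc i \<noteq> k" using nnk n by auto
      then have "Suc i \<in> ?S" using i nle by simp
      then have "Suc i \<le> gap n" unfolding gap_def using Max_ge[OF fin] by blast
      then show False using eq by simp
    qed
    then show "nn i \<le> n \<and> n < nn (Suc i)" using gap eq by simp
  next
    assume ni: "nn i \<le> n \<and> n < nn (Suc i)"
    then have "i \<le> gap n" unfolding gap_def using Max_ge[OF fin, of i] i by simp
    moreover have "gap n \<le> i"
    proof (rule ccontr)
      assume "\<not> gap n \<le> i"
      then have "nn (Suc i) \<le> nn (gap n)" using gap by (intro nn_mono) auto
      then show False using gap ni by simp
    qed
    ultimately show "gap n = i" by simp
  qed
qed

lemma gap_less: "gap n < k"
proof -
  let ?S = "{i. i < k \<and> nn i \<le> n}"
  have fin: "finite ?S" and ne: "?S \<noteq> {}" using k2 nn0 by (auto intro: exI[of _ 0])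
  show ?thesis using Max_in[OF fin ne] unfolding gap_def by simp
qed

lemma pos_fpow: "n < period d0 \<Longrightarrow> pos ((fp ^^ n) d0) = n"
  unfolding pos_def using the_inv_into_f_f[OF fpow_inj_on_period[OF d0], of n] by simp

lemma blk_fpow: "n < period d0 \<Longrightarrow> blk ((fp ^^ n) d0) = Inl (gap n)"
  unfolding blk_def using pos_fpow orb_period[OF d0] by auto

lemma darts_of_gap:
  assumes i: "i < k"
  shows "{d \<in> darts E. blk d = Inl i} = (\<lambda>n. (fp ^^ n) d0) ` {nn i..<nn (Suc i)}"
proof
  show "{d \<in> darts E. blk d = Inl i} \<subseteq> (\<lambda>n. (fp ^^ n) d0) ` {nn i..<nn (Suc i)}"
  proof
    fix d assume "d \<in> {d \<in> darts E. blk d = Inl i}"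
    then have d: "blk d = Inl i" by simp
    then have "d \<in> orb d0" unfolding blk_def by (auto split: if_splits)
    then obtain n where n: "n < period d0" "d = (fp ^^ n) d0" using orb_period[OF d0] by auto
    then have "gap n = i" using d blk_fpow by simp
    then show "d \<in> (\<lambda>n. (fp ^^ n) d0) ` {nn i..<nn (Suc i)}" using gap_iff[OF n(1) i] n(2) by simp
  qed
  show "(\<lambda>n. (fp ^^ n) d0) ` {nn i..<nn (Suc i)} \<subseteq> {d \<in> darts E. blk d = Inl i}"
  proof (rule image_subsetI)
    fix n assume n: "n \<in> {nn i..<nn (Suc i)}"
    have "nn (Suc i) \<le> period d0" using nn_mono[of "Suc i" k] nnk i by simp
    then have n': "n < period d0" using n by simp
    then have "gap n = i" using gap_iff[OF n' i] n by simp
    then show "(fp ^^ n) d0 \<in> {d \<in> darts E. blk d = Inl i}"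
      using blk_fpow[OF n'] fpow_in[OF d0] by simp
  qed
qed

lemma darts_of_face:
  assumes f: "f \<in> faces E \<sigma>" "f \<noteq> orb d0"
  shows "{d \<in> darts E. blk d = Inr f} = f"
proof
  show "{d \<in> darts E. blk d = Inr f} \<subseteq> f"
    using orb_self unfolding blk_def by (auto split: if_splits)
  show "f \<subseteq> {d \<in> darts E. blk d = Inr f}"
  proof
    fix d assume d: "d \<in> f"
    have "d \<notin> orb d0" using orb_eq[OF d0, of d] face_eq_orb(2)[OF f(1) d] f(2) by metis
    then show "d \<in> {d \<in> darts E. blk d = Inr f}"
      using face_eq_orb[OF f(1) d] unfolding blk_def by simp
  qed
qed

lemma blk_in:
  assumes "d \<in> darts E"
  shows "blk d \<in> blocks"
proof (cases "d \<in> orb d0")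
  case True
  then show ?thesis unfolding blk_def blocks_def gaps_def using gap_less by simp
next
  case False
  then have "orb d \<noteq> orb d0" using orb_self[of d] by metis
  then show ?thesis using False assms unfolding blk_def blocks_def faces_eq by simp
qed

lemma edge_Min_Max:
  assumes "e \<in> E"
  shows "(Min e, Max e) \<in> darts E" "(Max e, Min e) \<in> darts E" "edge (Min e, Max e) = e"
    "edge (Max e, Min e) = e" "Min e < Max e"
proof -
  obtain u v where "e = {u, v}" "u \<noteq> v" using edgeE[OF assms] by metis
  then show "edge (Min e, Max e) = e" "edge (Max e, Min e) = e" "Min e < Max e"
    unfolding edge_def by (cases "u < v"; simp add: insert_commute)+
  then show "(Min e, Max e) \<in> darts E" "(Max e, Min e) \<in> darts E" using assms dart_iff by simp_all
qed

lemma edge_Min_Max_cases: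
  assumes "d \<in> darts E"
  shows "d = (Min (edge d), Max (edge d)) \<or> d = (Max (edge d), Min (edge d))"
  using dart_in[OF assms] unfolding edge_def
  by (cases d; cases "fst d < snd d") auto

lemma verts_iff:
  assumes "A \<subseteq> E"
  shows "x \<in> dual.verts A \<longleftrightarrow> (\<exists>d\<in>darts E. blk d = x \<and> edge d \<in> A)"
proof
  assume "x \<in> dual.verts A"
  then obtain e where e: "e \<in> A" "x = lend e \<or> x = rend e" unfolding dual.verts_def by blast
  then have "e \<in> E" using assms by blast
  from e(2) show "\<exists>d\<in>darts E. blk d = x \<and> edge d \<in> A"
    using edge_Min_Max[OF \<open>e \<in> E\<close>] e(1) unfolding lend_def rend_def by metis
next
  assume "\<exists>d\<in>darts E. blk d = x \<and> edge d \<in> A"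
  then obtain d where d: "d \<in> darts E" "blk d = x" "edge d \<in> A" by blast
  then have "x = lend (edge d) \<or> x = rend (edge d)"
    using edge_Min_Max_cases[OF d(1)] unfolding lend_def rend_def by metis
  then show "x \<in> dual.verts A" using d(3) unfolding dual.verts_def by blast
qed

text \<open>Face walks run over darts, whereas \<open>bd\<close> counts edges. An edge with both
  sides in \<open>x\<close> is ignored by \<open>bd\<close> and has two darts here, so the parities
  agree.\<close>

lemma bd_iff:
  assumes A: "A \<subseteq> E"
  shows "x \<in> dual.bd A \<longleftrightarrow> odd (card {d \<in> darts E. blk d = x \<and> edge d \<in> A})"
proof -
  let ?L = "{e \<in> A. lend e = x}" and ?R = "{e \<in> A. rend e = x}"
  have fin: "finite ?L" "finite ?R" using finite_subset[OF A finite_E] by simp_all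
  let ?f = "\<lambda>e. (Min e, Max e)" and ?g = "\<lambda>e. (Max e, Min e)"
  have inj: "inj_on ?f ?L" "inj_on ?g ?R"
    by (rule inj_onI, use edge_Min_Max(3,4) A in \<open>metis (no_types, lifting) mem_Collect_eq subsetD\<close>)+
  have disj: "?f ` ?L \<inter> ?g ` ?R = {}"
  proof (rule ccontr)
    assume "?f ` ?L \<inter> ?g ` ?R \<noteq> {}"
    then obtain e e' where e: "e \<in> ?L" "e' \<in> ?R" "?f e = ?g e'" by blast
    then have "Min e < Max e" "Min e' < Max e'" using edge_Min_Max(5) A by blast+
    then show False using e(3) by simp
  qed
  have "{d \<in> darts E. blk d = x \<and> edge d \<in> A} = ?f ` ?L \<union> ?g ` ?R"
  proof
    show "{d \<in> darts E. blk d = x \<and> edge d \<in> A} \<subseteq> ?f ` ?L \<union> ?g ` ?R"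
    proof
      fix d assume "d \<in> {d \<in> darts E. blk d = x \<and> edge d \<in> A}"
      then have d: "d \<in> darts E" "blk d = x" "edge d \<in> A" by simp_all
      from edge_Min_Max_cases[OF d(1)] show "d \<in> ?f ` ?L \<union> ?g ` ?R"
      proof
        assume *: "d = ?f (edge d)"
        then have "edge d \<in> ?L" using d unfolding lend_def by simp
        then show ?thesis using * by blast
      next
        assume *: "d = ?g (edge d)"
        then have "edge d \<in> ?R" using d unfolding rend_def by simp
        then show ?thesis using * by blast
      qed
    qed
    show "?f ` ?L \<union> ?g ` ?R \<subseteq> {d \<in> darts E. blk d = x \<and> edge d \<in> A}"
      using edge_Min_Max(1-4) A unfolding lend_def rend_def by auto
  qed
  then have "card {d \<in> darts E. blk d = x \<and> edge d \<in> A} = card ?L + card ?R"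
    using card_Un_disjoint[OF _ _ disj] fin inj by (simp add: card_image)
  moreover have "{e \<in> A. (lend e = x) \<noteq> (rend e = x)} = ?L \<triangle> ?R" by blast
  then have "x \<in> dual.bd A \<longleftrightarrow> odd (card (?L \<triangle> ?R))"
    unfolding dual.bd_def mem_Collect_eq by (rule arg_cong)
  ultimately show ?thesis using odd_card_sym_diff[OF fin] by presburger
qed

text \<open>The walk through gap \<open>i\<close> starts at terminal \<open>i\<close> and ends at
  the next one.\<close>

lemma bd_cutset_gap:
  assumes "i < k"
  shows "Inl i \<in> dual.bd (cutset E W) \<longleftrightarrow> (tm i \<in> W) \<noteq> (tm (Suc i) \<in> W)"
proof -
  have le: "nn i \<le> nn (Suc i)" "nn (Suc i) \<le> period d0"
    using nn_less[OF assms] nn_mono[of "Suc i" k] nnk assms by simp_all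
  have eq: "{d \<in> darts E. blk d = Inl i \<and> edge d \<in> cutset E W} =
      {d \<in> (\<lambda>n. (fp ^^ n) d0) ` {nn i..<nn (Suc i)}. edge d \<in> cutset E W}"
    using darts_of_gap[OF assms] by blast
  have sub: "cutset E W \<subseteq> E" unfolding cutset_def by blast
  have "Inl i \<in> dual.bd (cutset E W) \<longleftrightarrow>
      odd (card {d \<in> (\<lambda>n. (fp ^^ n) d0) ` {nn i..<nn (Suc i)}. edge d \<in> cutset E W})"
    by (rule bd_iff[OF sub, of "Inl i", unfolded eq])
  then show ?thesis using odd_crossings[OF d0 le, of W] unfolding tm_def by (rule trans)
qed

lemma verts_subset_blocks:
  assumes "A \<subseteq> E"
  shows "dual.verts A \<subseteq> blocks"
proof
  fix x assume "x \<in> dual.verts A"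
  then obtain d where "d \<in> darts E" "blk d = x" using verts_iff[OF assms, of x] by blast
  then show "x \<in> blocks" using blk_in by metis
qed

lemma bd_subset_blocks: "A \<subseteq> E \<Longrightarrow> dual.bd A \<subseteq> blocks"
  using dual.bd_subset_verts verts_subset_blocks by (rule subset_trans)

text \<open>The walk around any other face returns to its start and so crosses the cut an even
  number of times.\<close>

lemma bd_cutset_subset: "dual.bd (cutset E W) \<subseteq> gaps"
proof
  fix x assume x: "x \<in> dual.bd (cutset E W)"
  have sub: "cutset E W \<subseteq> E" unfolding cutset_def by blast
  show "x \<in> gaps"
  proof (rule ccontr)
    assume "x \<notin> gaps"
    then obtain f where f: "x = Inr f" "f \<in> faces E \<sigma>" "f \<noteq> orb d0"
      using bd_subset_blocks[OF sub] x unfolding blocks_def by blast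
    then obtain d where d: "d \<in> darts E" "f = orb d" unfolding faces_eq by blast
    have "{d' \<in> darts E. blk d' = x \<and> edge d' \<in> cutset E W} = {d' \<in> f. edge d' \<in> cutset E W}"
      using darts_of_face[OF f(2,3)] f(1) by blast
    also have "f = (\<lambda>n. (fp ^^ n) d) ` {0..<period d}"
      using orb_period[OF d(1)] d(2) by (simp only: atLeast0LessThan)
    finally have eq: "{d' \<in> darts E. blk d' = x \<and> edge d' \<in> cutset E W} =
      {d' \<in> (\<lambda>n. (fp ^^ n) d) ` {0..<period d}. edge d' \<in> cutset E W}" .
    have "odd (card {d' \<in> darts E. blk d' = x \<and> edge d' \<in> cutset E W})"
      using x bd_iff[OF sub, of x] by blast
    then show False
      unfolding eq using odd_crossings[OF d(1), of 0 "period d" W] period(2)[OF d(1)] by simp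
  qed
qed

text \<open>Crossing edges and following faces lead from any dart to any other, because together
  they rotate about a vertex and the graph is connected. Following a face stays at one dual vertex
  except on the terminal face, where it passes from gap to gap. Consecutive gaps are therefore
  joined by the star of the terminal between them, a cut whose only odd blocks are these two
  gaps.\<close>

lemma dual_joined:
  assumes "x \<in> blocks" "y \<in> blocks"
  shows "\<exists>A\<subseteq>E. dual.joins A x y"
proof -
  define J where "J x y \<longleftrightarrow> (\<exists>A\<subseteq>E. dual.joins A x y)" for x y
  have J_refl: "J x x" for x unfolding J_def by (intro exI[of _ "{}"]) simp
  have J_sym: "J y x" if "J x y" for x y using that dual.joins_sym unfolding J_def by blast
  have J_trans: "J x z" if xy: "J x y" and yz: "J y z" for x y z
  proof -
    obtain A B where A: "A \<subseteq> E" "dual.joins A x y" and B: "B \<subseteq> E" "dual.joins B y z"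
      using xy yz unfolding J_def by blast
    have "dual.joins (A \<triangle> B) x z"
      using dual.joins_trans[OF _ _ A(2) B(2)] A(1) B(1) finite_E finite_subset by blast
    moreover have "A \<triangle> B \<subseteq> E" using A(1) B(1) by blast
    ultimately show ?thesis unfolding J_def by blast
  qed
  have J_gap_Suc: "J (Inl i) (Inl (Suc i))" if i: "Suc i < k" for i
  proof -
    have iff: "Inl j \<in> dual.bd (cutset E {tm (Suc i)}) \<longleftrightarrow> j = i \<or> j = Suc i" if j: "j < k" for j
    proof (cases "Suc j = k")
      case True
      then have "tm (Suc j) = tm 0" using tm_k by simp
      then have "tm (Suc j) \<noteq> tm (Suc i)" using tm_eq_iff[of 0 "Suc i"] i by simp
      moreover have "j \<noteq> i" using True i by simp
      ultimately show ?thesis using bd_cutset_gap[OF j, of "{tm (Suc i)}"] tm_eq_iff[OF j i] by simp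
    next
      case False
      then have iff: "tm (Suc j) = tm (Suc i) \<longleftrightarrow> j = i" using tm_eq_iff[of "Suc j" "Suc i"] j i by simp
      have "Inl j \<in> dual.bd (cutset E {tm (Suc i)}) \<longleftrightarrow> (j = Suc i) \<noteq> (j = i)"
        using bd_cutset_gap[OF j, of "{tm (Suc i)}"] by (simp only: singleton_iff iff tm_eq_iff[OF j i])
      then show ?thesis by (cases "j = i") simp_all
    qed
    have "x \<in> dual.bd (cutset E {tm (Suc i)}) \<longleftrightarrow> x = Inl i \<or> x = Inl (Suc i)" for x
    proof (cases "x \<in> gaps")
      case True
      then obtain j where "j < k" "x = Inl j" unfolding gaps_def by blast
      then show ?thesis using iff by simp
    next
      case False
      moreover have "Inl i \<in> gaps" "Inl (Suc i) \<in> gaps" using i unfolding gaps_def by simp_all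
      ultimately show ?thesis using bd_cutset_subset by blast
    qed
    then have "dual.bd (cutset E {tm (Suc i)}) = {Inl i, Inl (Suc i)}" by (intro set_eqI) simp
    then have "dual.joins (cutset E {tm (Suc i)}) (Inl i) (Inl (Suc i))" by (subst dual.joins_iff) simp_all
    moreover have "cutset E {tm (Suc i)} \<subseteq> E" unfolding cutset_def by blast
    ultimately show ?thesis unfolding J_def by blast
  qed
  have J_gap0: "J (Inl 0) (Inl i)" if "i < k" for i
    using that
  proof (induction i)
    case (Suc i)
    then show ?case using J_trans[OF _ J_gap_Suc[of i]] by simp
  qed (rule J_refl)
  have J_gaps: "J (Inl i) (Inl j)" if "i < k" "j < k" for i j
    using J_trans[OF J_sym[OF J_gap0[OF that(1)]] J_gap0[OF that(2)]] .
  have J_edge: "J (blk (u, v)) (blk (v, u))" if uv: "(u, v) \<in> darts E" for u v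
  proof -
    have e: "edge (u, v) \<in> E" using uv dart_iff by blast
    have "J (lend (edge (u, v))) (rend (edge (u, v)))"
      unfolding J_def using e dual.joins_edge by (intro exI[of _ "{edge (u, v)}"]) simp
    then show ?thesis using edge_Min_Max_cases[OF uv] J_sym unfolding lend_def rend_def by auto
  qed
  have J_fp: "J (blk d) (blk (fp d))" if d: "d \<in> darts E" for d
  proof (cases "d \<in> orb d0")
    case True
    then have "fp d \<in> orb d0" using fp_in_orb[of d] orb_eq[OF d0] by blast
    then show ?thesis using True J_gaps gap_less unfolding blk_def by simp
  next
    case False
    have "orb (fp d) = orb d" using orb_eq[OF d fp_in_orb] .
    moreover have "fp d \<notin> orb d0" using False orb_self[of d] orb_eq[OF d0, of "fp d"] calculation by auto
    ultimately have "blk (fp d) = blk d" using False unfolding blk_def by simp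
    then show ?thesis using J_refl by simp
  qed
  \<comment> \<open>One step of the rotation at \<open>v\<close>: cross the edge, then take the next
    dart of that face.\<close>
  have J_rot1: "J (blk (v, u)) (blk (v, \<sigma> v u)) \<and> (v, \<sigma> v u) \<in> darts E" if vu: "(v, u) \<in> darts E" for u v
  proof -
    have uv: "(u, v) \<in> darts E" using vu nbrs_iff by blast
    have "fp (u, v) = (v, \<sigma> v u)" unfolding face_perm_def by simp
    then show ?thesis using J_trans[OF J_edge[OF vu] J_fp[OF uv]] fp_in[OF uv] by simp
  qed
  have J_rotn: "J (blk (v, u)) (blk (v, (\<sigma> v ^^ n) u)) \<and> (v, (\<sigma> v ^^ n) u) \<in> darts E"
    if vu: "(v, u) \<in> darts E" for u v n
  proof (induction n)
    case (Suc n)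
    then have IH: "J (blk (v, u)) (blk (v, (\<sigma> v ^^ n) u))" "(v, (\<sigma> v ^^ n) u) \<in> darts E" by simp_all
    then show ?case using J_rot1[OF IH(2)] J_trans[OF IH(1)] by simp
  qed (use vu J_refl in simp)
  have J_vertex: "J (blk (v, u)) (blk (v, u'))" if vu: "(v, u) \<in> darts E" "(v, u') \<in> darts E" for v u u'
  proof -
    have "v \<in> V" using dart_in[OF vu(1)] by simp
    then obtain n where "(\<sigma> v ^^ n) u = u'" using rot_trans vu nbrs_iff(2) by blast
    then show ?thesis using J_rotn[OF vu(1), of n] by simp
  qed
  have J_darts: "J (blk (u, x)) (blk (v, y))"
    if uv: "(u, v) \<in> {(x, y). {x, y} \<in> E}\<^sup>*" and ux: "(u, x) \<in> darts E" and vy: "(v, y) \<in> darts E" for u v x y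
    using uv vy
  proof (induction arbitrary: y rule: rtrancl_induct)
    case base
    then show ?case using J_vertex ux by blast
  next
    case (step v z)
    have vz: "(v, z) \<in> darts E" "(z, v) \<in> darts E"
      using step.hyps(2) unfolding darts_def by (simp_all add: insert_commute)
    show ?case
      using J_trans[OF J_trans[OF step.IH[OF vz(1)] J_edge[OF vz(1)]] J_vertex[OF vz(2) step.prems]] .
  qed
  have "\<exists>d\<in>darts E. blk d = x" if "x \<in> blocks" for x
  proof (cases x)
    case (Inl i)
    then have i: "i < k" using that unfolding blocks_def gaps_def by auto
    have "(fp ^^ nn i) d0 \<in> {d \<in> darts E. blk d = Inl i}"
      unfolding darts_of_gap[OF i] using nn_less[OF i] by simp
    then show ?thesis using Inl by blast
  next
    case (Inr f)
    then have f: "f \<in> faces E \<sigma>" "f \<noteq> orb d0" using that unfolding blocks_def gaps_def by auto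
    then obtain d where "d \<in> f" unfolding faces_eq using orb_self by blast
    then show ?thesis using darts_of_face[OF f] Inr by blast
  qed
  then obtain d d' where d: "d \<in> darts E" "blk d = x" and d': "d' \<in> darts E" "blk d' = y"
    using assms by meson
  have "J (blk (fst d, snd d)) (blk (fst d', snd d'))"
    using d(1) d'(1) dart_in by (intro J_darts connected_V) auto
  then show ?thesis using d(2) d'(2) unfolding J_def by simp
qed

end

section \<open>Cuts and joins in the split dual\<close>

context disc_network
begin

lemma finite_sub: "A \<subseteq> E \<Longrightarrow> finite A"
  using finite_E finite_subset by blast

text \<open>Modulo the gaps, every set \<open>Y\<close> of non-terminal faces is the boundary of
  some \<open>D Y\<close>. The translates of \<open>Z\<close> by the \<open>D Y\<close> are
  therefore disjoint, and \<open>Z\<close> has at most \<open>2 ^ (card E - card Fi)\<close>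
  elements. By Euler's formula that is \<open>2 ^ (card V - 1)\<close>, the number of cuts, which
  all lie in \<open>Z\<close>.\<close>

lemma cut_if_bd_subset_gaps:
  assumes "A \<subseteq> E" "dual.bd A \<subseteq> gaps"
  shows "\<exists>W\<subseteq>V. A = cutset E W"
proof -
  define Fi where "Fi = (Inr ` (faces E \<sigma> - {orb d0}) :: (nat + (nat \<times> nat) set) set)"
  have finFi: "finite Fi" unfolding Fi_def using finite_faces by simp
  have orb0: "orb d0 \<in> faces E \<sigma>" unfolding faces_eq using d0 by simp
  have cardFi: "card Fi = card (faces E \<sigma>) - 1"
    unfolding Fi_def using orb0 finite_faces by (simp add: card_image)
  have disj: "x \<notin> gaps" if "x \<in> Fi" for x using that unfolding Fi_def gaps_def by auto
  \<comment> \<open>A join from a face to gap 0 toggles just that face once gaps are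
    disregarded.\<close>
  have "\<exists>A\<subseteq>E. dual.bd A - gaps = Y" if "Y \<subseteq> Fi" for Y
    using finite_subset[OF that finFi] that
  proof (induction Y rule: finite_induct)
    case empty
    show ?case by (intro exI[of _ "{}"]) simp
  next
    case (insert x Y)
    then obtain A where A: "A \<subseteq> E" "dual.bd A - gaps = Y" by blast
    have gap0: "Inl 0 \<in> gaps" unfolding gaps_def using k2 by simp
    have "x \<in> blocks" "Inl 0 \<in> blocks" using insert.prems gap0 unfolding blocks_def Fi_def by auto
    then obtain B where B: "B \<subseteq> E" "dual.joins B x (Inl 0)" using dual_joined by blast
    have x: "x \<notin> gaps" using disj insert.prems by blast
    have "dual.bd (A \<triangle> B) = dual.bd A \<triangle> ({x} \<triangle> {Inl 0})"
      using dual.bd_sym_diff[of A B] finite_sub A(1) B unfolding dual.joins_def by simp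
    then have "dual.bd (A \<triangle> B) - gaps = (dual.bd A - gaps) \<triangle> {x}" using x gap0 by auto
    also have "\<dots> = insert x Y" unfolding A(2) using insert.hyps by auto
    finally show ?case using A(1) B(1) by (intro exI[of _ "A \<triangle> B"]) auto
  qed
  then obtain D where D: "\<And>Y. Y \<subseteq> Fi \<Longrightarrow> D Y \<subseteq> E \<and> dual.bd (D Y) - gaps = Y"
    by metis
  define Z where "Z = {A. A \<subseteq> E \<and> dual.bd A \<subseteq> gaps}"
  have finZ: "finite Z" unfolding Z_def using finite_E by simp
  have "inj_on (\<lambda>(C, Y). C \<triangle> D Y) (Z \<times> Pow Fi)"
  proof (rule inj_onI, clarify)
    fix C Y C' Y' assume C: "C \<in> Z" "C' \<in> Z" and Y: "Y \<subseteq> Fi" "Y' \<subseteq> Fi"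
      and eq: "C \<triangle> D Y = C' \<triangle> D Y'"
    have rec: "dual.bd (C \<triangle> D Y) - gaps = Y" if C: "C \<in> Z" and Y: "Y \<subseteq> Fi" for C Y
    proof -
      have bdC: "C \<subseteq> E" "dual.bd C \<subseteq> gaps" using C unfolding Z_def by simp_all
      have "dual.bd (C \<triangle> D Y) = dual.bd C \<triangle> dual.bd (D Y)"
        by (rule dual.bd_sym_diff) (use finite_sub bdC(1) D[OF Y] in blast)+
      then have "dual.bd (C \<triangle> D Y) - gaps = dual.bd (D Y) - gaps" using bdC(2) by blast
      then show ?thesis using D[OF Y] by simp
    qed
    have "Y = Y'" using rec[OF C(1) Y(1)] rec[OF C(2) Y(2)] eq by simp
    moreover from this have "C = C'" using eq by blast
    ultimately show "C = C' \<and> Y = Y'" by simp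
  qed
  moreover have "(\<lambda>(C, Y). C \<triangle> D Y) ` (Z \<times> Pow Fi) \<subseteq> Pow E"
  proof (rule image_subsetI)
    fix p assume "p \<in> Z \<times> Pow Fi"
    then obtain C Y where p: "p = (C, Y)" "C \<subseteq> E" "Y \<subseteq> Fi" unfolding Z_def by blast
    then show "(\<lambda>(C, Y). C \<triangle> D Y) p \<in> Pow E" using D[of Y] by auto
  qed
  ultimately have "card (Z \<times> Pow Fi) \<le> card (Pow E)" using finite_E by (intro card_inj_on_le) auto
  then have le: "card Z * 2 ^ card Fi \<le> 2 ^ card E"
    using finFi finite_E by (simp add: card_cartesian_product card_Pow)
  obtain v0 where v0: "v0 \<in> V" using net unfolding is_network_def by blast
  define C where "C = cutset E ` Pow (V - {v0})"
  have "inj_on (cutset E) (Pow (V - {v0}))"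
  proof (rule inj_onI)
    fix W W' assume "W \<in> Pow (V - {v0})" "W' \<in> Pow (V - {v0})" "cutset E W = cutset E W'"
    then show "W = W'" by (intro cutset_determines[OF _ _ _ v0]) auto
  qed
  then have cardC: "card C = 2 ^ (card V - 1)"
    unfolding C_def using v0 finite_V by (simp add: card_image card_Pow)
  have CZ: "C \<subseteq> Z" unfolding C_def Z_def using bd_cutset_subset by (auto simp: cutset_def)
  have "card V \<noteq> 0" "card (faces E \<sigma>) \<noteq> 0" using v0 finite_V orb0 finite_faces by auto
  then have "card E = (card V - 1) + card Fi" using euler cardFi by linarith
  then have "card Z * 2 ^ card Fi \<le> card C * 2 ^ card Fi" using le cardC by (simp add: power_add)
  then have "card Z \<le> card C" by simp
  then have "C = Z" using card_seteq[OF finZ CZ] by blast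
  moreover have "A \<in> Z" unfolding Z_def using assms by simp
  ultimately show ?thesis unfolding C_def by blast
qed

lemma mono_coloured_gap:
  assumes i: "i < k" and dd: "d \<in> darts E" "blk d = Inl i" and none: "Inl i \<notin> dual.verts (cutset E W)"
  shows "fst d \<in> W \<longleftrightarrow> tm i \<in> W"
proof -
  obtain n where n: "n \<in> {nn i..<nn (Suc i)}" "d = (fp ^^ n) d0"
    using darts_of_gap[OF i] dd by blast
  have sub: "cutset E W \<subseteq> E" unfolding cutset_def by blast
  have "j < nn (Suc i) \<longrightarrow> (fst ((fp ^^ j) d0) \<in> W \<longleftrightarrow> tm i \<in> W)" if "nn i \<le> j" for j
    using that
  proof (induction j rule: dec_induct)
    case base
    then show ?case unfolding tm_def by simp
  next
    case (step j)
    show ?case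
    proof
      assume j: "Suc j < nn (Suc i)"
      then have "(fp ^^ j) d0 \<in> (\<lambda>n. (fp ^^ n) d0) ` {nn i..<nn (Suc i)}" using step.hyps by simp
      then have "(fp ^^ j) d0 \<in> darts E" "blk ((fp ^^ j) d0) = Inl i" using darts_of_gap[OF i] by blast+
      then have "edge ((fp ^^ j) d0) \<notin> cutset E W" using none verts_iff[OF sub] by blast
      then have "fst ((fp ^^ j) d0) \<in> W \<longleftrightarrow> fst ((fp ^^ Suc j) d0) \<in> W"
        using edge_cutset[OF fpow_in[OF d0]] fst_fpow_Suc by metis
      then show "fst ((fp ^^ Suc j) d0) \<in> W \<longleftrightarrow> tm i \<in> W" using step.IH j by simp
    qed
  qed
  then show ?thesis using n by simp
qed

text \<open>The walk along the boundary of a block changes sides only at cut edges. Gaps are treated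
  apart because the walk through a gap does not close up.\<close>

lemma mono_coloured:
  assumes x: "x \<in> blocks" "x \<notin> dual.verts (cutset E W)"
    and d: "d \<in> darts E" "blk d = x" and d': "d' \<in> darts E" "blk d' = x"
  shows "fst d \<in> W \<longleftrightarrow> fst d' \<in> W"
proof (cases x)
  case (Inl i)
  then have "i < k" using x(1) unfolding blocks_def gaps_def by auto
  then show ?thesis using mono_coloured_gap[of i] Inl d d' x(2) by blast
next
  case (Inr f)
  then have f: "f \<in> faces E \<sigma>" "f \<noteq> orb d0" using x(1) unfolding blocks_def gaps_def by auto
  have mem: "z \<in> f \<longleftrightarrow> z \<in> darts E \<and> blk z = x" for z
  proof -
    have "z \<in> f \<longleftrightarrow> z \<in> {d \<in> darts E. blk d = Inr f}" by (simp only: darts_of_face[OF f])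
    then show ?thesis using Inr by simp
  qed
  have df: "d \<in> f" "d' \<in> f" using mem d d' by simp_all
  have sub: "cutset E W \<subseteq> E" unfolding cutset_def by blast
  have step: "fst d'' \<in> W \<longleftrightarrow> fst (fp d'') \<in> W" if "d'' \<in> f" for d''
  proof -
    have d'': "d'' \<in> darts E" "blk d'' = x" using mem that by simp_all
    then have "edge d'' \<notin> cutset E W" using x(2) verts_iff[OF sub] by blast
    then show ?thesis using edge_cutset[OF d''(1)] unfolding face_perm_def by simp
  qed
  have feq: "f = orb d" using face_eq_orb(2)[OF f(1) df(1)] .
  have "fst d \<in> W \<longleftrightarrow> fst ((fp ^^ n) d) \<in> W" for n
  proof (induction n)
    case (Suc n)
    have "(fp ^^ n) d \<in> f" unfolding feq orb_def by blast
    then show ?case using Suc step[of "(fp ^^ n) d"] by simp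
  qed simp
  moreover obtain n where "d' = (fp ^^ n) d" using df(2) unfolding feq orb_def by blast
  ultimately show ?thesis by simp
qed

text \<open>If no block touched both joins, every block on \<open>Q\<close> would lie on one side of the cut \<open>P\<close>, and the
  edges of \<open>Q\<close> on the side of terminal \<open>i\<close> would have gap \<open>i\<close> as their only odd block.\<close>

lemma joins_cross:
  assumes ord: "a \<le> i" "i < b" "b \<le> j" "j < k"
    and P: "P \<subseteq> E" "dual.joins P (Inl a) (Inl b)"
    and Q: "Q \<subseteq> E" "dual.joins Q (Inl i) (Inl j)"
  shows "dual.verts P \<inter> dual.verts Q \<noteq> {}"
proof
  assume disj: "dual.verts P \<inter> dual.verts Q = {}"
  have bdP: "dual.bd P = {Inl a, Inl b}" and bdQ: "dual.bd Q = {Inl i, Inl j}"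
    using P(2) Q(2) ord dual.joins_iff[of "Inl a" "Inl b" P] dual.joins_iff[of "Inl i" "Inl j" Q] by simp_all
  have touch: "Inl a \<in> dual.verts P" "Inl b \<in> dual.verts P" "Inl i \<in> dual.verts Q" "Inl j \<in> dual.verts Q"
    using dual.bd_subset_verts[of P] dual.bd_subset_verts[of Q] bdP bdQ by simp_all
  \<comment> \<open>Each of the four gaps is odd in one of the joins and hence touched by it, so
    disjointness makes these inequalities strict.\<close>
  then have "a \<noteq> i" "b \<noteq> j" using disj by blast+
  then have lt: "a < i" "b < j" using ord by simp_all
  have "dual.bd P \<subseteq> gaps" unfolding bdP gaps_def using ord by simp
  then obtain W where W: "P = cutset E W" using cut_if_bd_subset_gaps[OF P(1)] by blast
  have change: "(tm n \<in> W) \<noteq> (tm (Suc n) \<in> W) \<longleftrightarrow> n = a \<or> n = b" if "n < k" for n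
    using bd_cutset_gap[OF that, of W] bdP W by simp
  \<comment> \<open>From terminal \<open>i\<close> on the cut changes sides only at gap
    \<open>b\<close>, since \<open>a < i\<close>: the terminals after \<open>b\<close> are on the
    other side.\<close>
  have "n < k \<longrightarrow> ((tm n \<in> W) \<noteq> (tm i \<in> W) \<longleftrightarrow> b < n)" if "i \<le> n" for n
    using that
  proof (induction n rule: dec_induct)
    case (step n)
    have "b < Suc n \<longleftrightarrow> b < n \<or> n = b" by auto
    then show ?case using step change[of n] lt(1) by auto
  qed (use ord in simp)
  then have sides: "(tm j \<in> W) \<noteq> (tm i \<in> W)" using ord lt(2) by simp
  define side where "side x \<longleftrightarrow> (\<forall>d\<in>darts E. blk d = x \<longrightarrow> fst d \<in> W)" for x
  define Q1 where "Q1 = {e \<in> Q. e \<subseteq> W}"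
  have Q1E: "Q1 \<subseteq> E" unfolding Q1_def using Q(1) by blast
  have side_iff: "fst d \<in> W \<longleftrightarrow> side x"
    if d: "d \<in> darts E" "blk d = x" and x: "x \<in> dual.verts Q" for d x
  proof -
    have "x \<in> blocks" "x \<notin> dual.verts (cutset E W)"
      using x disj W verts_subset_blocks[OF Q(1)] by blast+
    then show ?thesis unfolding side_def using mono_coloured d by blast
  qed
  have "dual.bd Q1 = {x \<in> dual.bd Q. side x}"
  proof (rule set_eqI)
    fix x
    have "edge d \<in> Q1 \<longleftrightarrow> edge d \<in> Q \<and> side x" if d: "d \<in> darts E" "blk d = x" for d
    proof (cases "edge d \<in> Q")
      case True
      then have xQ: "x \<in> dual.verts Q" using verts_iff[OF Q(1)] d by blast
      then have "edge d \<notin> cutset E W"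
        using disj W verts_iff[OF P(1), of x] d by blast
      then have "fst d \<in> W \<longleftrightarrow> snd d \<in> W" using edge_cutset[OF d(1)] by blast
      then have "edge d \<subseteq> W \<longleftrightarrow> fst d \<in> W" unfolding edge_def by blast
      then show ?thesis using True side_iff[OF d xQ] unfolding Q1_def by simp
    qed (simp add: Q1_def)
    then have eq: "{d \<in> darts E. blk d = x \<and> edge d \<in> Q1} =
        (if side x then {d \<in> darts E. blk d = x \<and> edge d \<in> Q} else {})" by auto
    then show "x \<in> dual.bd Q1 \<longleftrightarrow> x \<in> {x \<in> dual.bd Q. side x}"
      unfolding mem_Collect_eq bd_iff[OF Q1E] bd_iff[OF Q(1)] eq by (cases "side x") simp_all
  qed
  moreover have "side (Inl n) \<longleftrightarrow> tm n \<in> W" if n: "n < k" "Inl n \<in> dual.verts Q" for n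
  proof -
    have d: "(fp ^^ nn n) d0 \<in> darts E" "blk ((fp ^^ nn n) d0) = Inl n"
      using darts_of_gap[OF n(1)] nn_less[OF n(1)] fpow_in[OF d0] by auto
    show ?thesis using side_iff[OF d n(2)] unfolding tm_def by simp
  qed
  then have "side (Inl i) \<noteq> side (Inl j)" using sides touch(3,4) ord by simp
  then have "card {x \<in> dual.bd Q. side x} = 1"
  proof (cases "side (Inl i)")
    case True
    then have "{x \<in> dual.bd Q. side x} = {Inl i}" using \<open>side (Inl i) \<noteq> side (Inl j)\<close> unfolding bdQ by auto
    then show ?thesis by simp
  next
    case False
    then have "{x \<in> dual.bd Q. side x} = {Inl j}" using \<open>side (Inl i) \<noteq> side (Inl j)\<close> unfolding bdQ by auto
    then show ?thesis by simp
  qed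
  ultimately show False using dual.even_card_bd[OF finite_sub[OF Q1E]] by simp
qed

text \<open>The gaps in the boundary are the places where the terminals change sides, so they fix
  the sides up to a global swap, which \<open>mincut\<close> permits.\<close>

lemma same_bd_same_cut:
  assumes "dual.bd (cutset E W') = dual.bd (cutset E W)"
  shows "W' \<inter> T = W \<inter> T \<or> W' \<inter> T = T - W"
proof -
  have "n < k \<Longrightarrow> (tm n \<in> W' \<longleftrightarrow> tm n \<in> W) \<longleftrightarrow> (tm 0 \<in> W' \<longleftrightarrow> tm 0 \<in> W)" for n
  proof (induction n)
    case (Suc n)
    have "(tm n \<in> W') \<noteq> (tm (Suc n) \<in> W') \<longleftrightarrow> (tm n \<in> W) \<noteq> (tm (Suc n) \<in> W)"
      using bd_cutset_gap[of n W] bd_cutset_gap[of n W'] assms Suc.prems by simp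
    then show ?case using Suc.IH Suc.prems by auto
  qed simp
  then have *: "(t \<in> W' \<longleftrightarrow> t \<in> W) \<longleftrightarrow> (tm 0 \<in> W' \<longleftrightarrow> tm 0 \<in> W)" if "t \<in> T" for t
    using that tm_T by blast
  show ?thesis
  proof (cases "tm 0 \<in> W' \<longleftrightarrow> tm 0 \<in> W")
    case True
    then have "W' \<inter> T = W \<inter> T" using * by blast
    then show ?thesis ..
  next
    case False
    then have "W' \<inter> T = T - W" using * by blast
    then show ?thesis ..
  qed
qed

text \<open>Generic weights and the spanner cost a factor \<open>1 + \<epsilon> / 3\<close> each;
  for \<open>\<epsilon> < 1\<close> the product is at most \<open>1 + \<epsilon>\<close>. The term
  \<open>12 / \<epsilon>\<close> is \<open>4 / (\<epsilon> / 3)\<close>.\<close>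

lemma approximating_edge_set:
  assumes eps: "0 < \<epsilon>" "\<epsilon> < 1"
  shows "\<exists>F N. F \<subseteq> E \<and>
    (\<forall>W\<subseteq>V. \<exists>W'\<subseteq>V. (W' \<inter> T = W \<inter> T \<or> W' \<inter> T = T - W) \<and> cutset E W' \<subseteq> F \<and>
      cut_weight E c W' \<le> (1 + \<epsilon>) * cut_weight E c W) \<and>
    real N \<le> real k * (log 2 (real k) + 1) * (12 / \<epsilon> + 3) \<and>
    card {D. D \<subseteq> F \<and> (\<exists>W\<subseteq>V. D = cutset E W)} \<le> 2 ^ (N * (2 * N + k))"
proof -
  have cpos: "0 < c e" if "e \<in> E" for e using net that unfolding is_network_def by blast
  obtain w where w: "\<And>e. e \<in> E \<Longrightarrow> c e \<le> w e \<and> w e \<le> (1 + \<epsilon> / 3) * c e" and winj: "inj_on (sum w) (Pow E)"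
    using generic_weights[where E = E and c = c and \<eta> = "\<epsilon> / 3"] finite_E cpos eps by auto
  have wpos: "0 < w e" if "e \<in> E" for e using w[OF that] cpos[OF that] by linarith
  interpret geodesic_graph lend rend E blocks w
  proof
    show "lend e \<in> blocks \<and> rend e \<in> blocks" if "e \<in> E" for e
      unfolding lend_def rend_def using blk_in edge_Min_Max[OF that] by simp
  qed (use finite_E wpos winj dual_joined in blast)+
  have gX: "Inl i \<in> blocks" if "i < k" for i using that unfolding blocks_def gaps_def by simp
  have "\<exists>F N. F \<subseteq> E \<and>
    (\<forall>i<k. \<forall>j<k. i \<noteq> j \<longrightarrow> (\<forall>Q\<subseteq>E. dual.joins Q (Inl i) (Inl j) \<longrightarrow>
      (\<exists>Q'\<subseteq>F. dual.joins Q' (Inl i) (Inl j) \<and> sum w Q' \<le> (1 + \<epsilon> / 3) * sum w Q))) \<and>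
    real N \<le> real k * (log 2 (real k) + 1) * (4 / (\<epsilon> / 3) + 3) \<and>
    card (closed_sub (Inl ` {..<k}) F) \<le> 2 ^ (N * (2 * N + k))"
  proof (rule spanner)
    show "1 \<le> k" "0 < \<epsilon> / 3" using k2 eps by simp_all
    show "dual.verts P \<inter> dual.verts Q \<noteq> {}"
      if "a \<le> i" "i < b" "b \<le> j" "j < k" "P \<subseteq> E" "dual.joins P (Inl a) (Inl b)" "Q \<subseteq> E" "dual.joins Q (Inl i) (Inl j)"
      for a b i j P Q
      using that by (rule joins_cross)
  qed (rule gX)
  then obtain F N where F: "F \<subseteq> E"
    and pair: "\<And>i j Q. \<lbrakk>i < k; j < k; i \<noteq> j; Q \<subseteq> E; dual.joins Q (Inl i) (Inl j)\<rbrakk> \<Longrightarrow>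
      \<exists>Q'\<subseteq>F. dual.joins Q' (Inl i) (Inl j) \<and> sum w Q' \<le> (1 + \<epsilon> / 3) * sum w Q"
    and N: "real N \<le> real k * (log 2 (real k) + 1) * (12 / \<epsilon> + 3)"
    and count: "card (closed_sub gaps F) \<le> 2 ^ (N * (2 * N + k))"
    unfolding gaps_def by auto
  \<comment> \<open>Cuts are relative cycles modulo the gaps, so the bound from the spanner counts
    them.\<close>
  have sub: "{D. D \<subseteq> F \<and> (\<exists>W\<subseteq>V. D = cutset E W)} \<subseteq> closed_sub gaps F"
    unfolding closed_sub_def using bd_cutset_subset by auto
  have "finite (closed_sub gaps F)" unfolding closed_sub_def using finite_sub[OF F] by simp
  then have "card {D. D \<subseteq> F \<and> (\<exists>W\<subseteq>V. D = cutset E W)} \<le> 2 ^ (N * (2 * N + k))"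
    using card_mono[OF _ sub] count order_trans by blast
  moreover have "\<exists>W'\<subseteq>V. (W' \<inter> T = W \<inter> T \<or> W' \<inter> T = T - W) \<and> cutset E W' \<subseteq> F \<and>
      cut_weight E c W' \<le> (1 + \<epsilon>) * cut_weight E c W" if "W \<subseteq> V" for W
  proof -
    let ?D = "cutset E W"
    have DE: "?D \<subseteq> E" unfolding cutset_def by blast
    have "\<exists>D'\<subseteq>F. dual.bd D' = dual.bd ?D \<and> sum w D' \<le> (1 + \<epsilon> / 3) * sum w ?D"
    proof (rule dual.join_stretch[OF finite_sub[OF DE] DE bd_cutset_subset finite_sub[OF F]])
      fix u v A assume u: "u \<in> gaps" "v \<in> gaps" "u \<noteq> v" and A: "A \<subseteq> E" "dual.bd A = {u, v}"
      then obtain i j where ij: "u = Inl i" "v = Inl j" "i < k" "j < k" "i \<noteq> j" unfolding gaps_def by blast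
      have "dual.joins A (Inl i) (Inl j)" using A(2) ij dual.joins_iff[of "Inl i" "Inl j" A] by simp
      then obtain Q' where "Q' \<subseteq> F" "dual.joins Q' (Inl i) (Inl j)" "sum w Q' \<le> (1 + \<epsilon> / 3) * sum w A"
        using pair[OF ij(3-5) A(1)] by blast
      then show "\<exists>A'\<subseteq>F. dual.bd A' = {u, v} \<and> sum w A' \<le> (1 + \<epsilon> / 3) * sum w A"
        using ij dual.joins_iff[of "Inl i" "Inl j" Q'] by (intro exI[of _ Q']) simp
    qed (use wpos F eps in \<open>auto simp: less_imp_le subset_iff\<close>)
    then obtain D' where D': "D' \<subseteq> F" "dual.bd D' = dual.bd ?D" "sum w D' \<le> (1 + \<epsilon> / 3) * sum w ?D"
      by blast
    have D'E: "D' \<subseteq> E" using D'(1) F by blast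
    have "dual.bd D' \<subseteq> gaps" using D'(2) bd_cutset_subset by metis
    then obtain W' where W': "W' \<subseteq> V" "D' = cutset E W'" using cut_if_bd_subset_gaps[OF D'E] by blast
    have "sum c D' \<le> sum w D'" using w D'E by (intro Groups_Big.sum_mono) blast
    also have "\<dots> \<le> (1 + \<epsilon> / 3) * sum w ?D" by (rule D'(3))
    also have "sum w ?D \<le> (\<Sum>e\<in>?D. (1 + \<epsilon> / 3) * c e)" using w DE by (intro Groups_Big.sum_mono) blast
    also have "\<dots> = (1 + \<epsilon> / 3) * sum c ?D" by (rule sum_distrib_left[symmetric])
    finally have "sum c D' \<le> (1 + \<epsilon> / 3) * ((1 + \<epsilon> / 3) * sum c ?D)" using eps by simp
    also have "\<dots> = (1 + 2 * \<epsilon> / 3 + \<epsilon> * \<epsilon> / 9) * sum c ?D" by (simp add: field_simps)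
    also have "\<dots> \<le> (1 + \<epsilon>) * sum c ?D"
    proof (rule mult_right_mono)
      have "\<epsilon> * \<epsilon> \<le> \<epsilon>" using eps by simp
      then show "1 + 2 * \<epsilon> / 3 + \<epsilon> * \<epsilon> / 9 \<le> 1 + \<epsilon>" using eps(1) by linarith
      show "0 \<le> sum c ?D" using cpos DE by (intro sum_nonneg) (auto simp: less_imp_le subset_iff)
    qed
    finally have "cut_weight E c W' \<le> (1 + \<epsilon>) * cut_weight E c W"
      unfolding cut_weight_cutset W'(2)[symmetric] .
    moreover have "W' \<inter> T = W \<inter> T \<or> W' \<inter> T = T - W"
      using same_bd_same_cut[of W' W] D'(2) W'(2) by simp
    ultimately show ?thesis using W' D'(1) by blast
  qed
  ultimately show ?thesis using F N by blast
qed

end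

text \<open>A terminal may occur several times on the boundary walk, for instance at a cut vertex;
  \<open>idx\<close> settles on the first occurrence. Starting at a terminal gives
  \<open>nn 0 = 0\<close>, and the value at \<open>card T\<close> closes the last gap at the end of
  the walk.\<close>

lemma (in embedded_network) terminal_positions:
  assumes f: "f \<in> faces E \<sigma>" "T \<subseteq> face_vertices f" and T2: "2 \<le> card T"
  shows "\<exists>d0 nn. d0 \<in> darts E \<and> nn 0 = 0 \<and> nn (card T) = period d0 \<and>
    (\<forall>i<card T. nn i < nn (Suc i)) \<and> bij_betw (\<lambda>i. fst ((fp ^^ nn i) d0)) {..<card T} T"
proof -
  obtain t0 where t0: "t0 \<in> T" using T2 by fastforce
  then obtain d0 where d0f: "d0 \<in> f" "fst d0 = t0" using f(2) unfolding face_vertices_def by blast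
  have d0: "d0 \<in> darts E" and feq: "f = orb d0" using face_eq_orb[OF f(1) d0f(1)] by blast+
  define v where "v n = fst ((fp ^^ n) d0)" for n
  define idx where "idx t = (LEAST n. v n = t)" for t
  have idx: "v (idx t) = t" "idx t < period d0" if "t \<in> T" for t
  proof -
    have "t \<in> fst ` (\<lambda>n. (fp ^^ n) d0) ` {..<period d0}"
      using f(2) that feq orb_period[OF d0] unfolding face_vertices_def by auto
    then obtain n where n: "n < period d0" "v n = t" unfolding v_def by auto
    show "v (idx t) = t" unfolding idx_def using n(2) by (rule LeastI)
    have "idx t \<le> n" unfolding idx_def using n(2) by (rule Least_le)
    then show "idx t < period d0" using n(1) by simp
  qed
  have idx0: "idx t0 = 0" unfolding idx_def using d0f(2) by (intro Least_equality) (simp_all add: v_def)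
  define I where "I = idx ` T"
  define ns where "ns = sorted_list_of_set I"
  define nn where "nn i = (if i < card T then ns ! i else period d0)" for i
  have finT: "finite T" using T2 by (intro card_ge_0_finite) simp
  have inj: "inj_on idx T" using idx(1) by (metis inj_onI)
  have finI: "finite I" and cardI: "card I = card T"
    unfolding I_def using finT inj by (simp_all add: card_image)
  have ns: "set ns = I" "distinct ns" "sorted_wrt (<) ns" "length ns = card T"
    unfolding ns_def using finI cardI by simp_all
  have nn_in: "nn i \<in> I" if "i < card T" for i
    using that ns(1,4) nth_mem[of i ns] unfolding nn_def by simp
  have less: "nn i < nn (Suc i)" if i: "i < card T" for i
  proof (cases "Suc i < card T")
    case True
    then show ?thesis using sorted_wrt_nth_less[OF ns(3), of i "Suc i"] ns(4) i unfolding nn_def by simp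
  next
    case False
    then have "nn (Suc i) = period d0" unfolding nn_def by simp
    then show ?thesis using nn_in[OF i] idx(2) unfolding I_def by auto
  qed
  have "nn 0 = 0"
  proof -
    have "0 \<in> set ns" using ns(1) idx0 t0 unfolding I_def by force
    then obtain i where i: "i < length ns" "ns ! i = 0" unfolding in_set_conv_nth by blast
    have "i = 0"
    proof (rule ccontr)
      assume "i \<noteq> 0"
      then have "ns ! 0 < ns ! i" using sorted_wrt_nth_less[OF ns(3), of 0 i] i(1) by simp
      then show False using i(2) by simp
    qed
    then show ?thesis unfolding nn_def using i(2) T2 by simp
  qed
  moreover have "nn (card T) = period d0" unfolding nn_def by simp
  moreover have "bij_betw (\<lambda>i. fst ((fp ^^ nn i) d0)) {..<card T} T"
  proof -
    have "bij_betw ((!) ns) {..<card T} I" using bij_betw_nth[OF ns(2)] ns(1,4) by simp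
    moreover have "nn i = ns ! i" if "i \<in> {..<card T}" for i using that unfolding nn_def by simp
    ultimately have "bij_betw nn {..<card T} I" using bij_betw_cong by metis
    moreover have "bij_betw v I T"
      by (rule bij_betw_byWitness[where f' = idx]) (use idx in \<open>auto simp: I_def\<close>)
    ultimately have "bij_betw (v \<circ> nn) {..<card T} T" by (rule bij_betw_trans)
    then show ?thesis unfolding v_def comp_def .
  qed
  ultimately show ?thesis using d0 less by blast
qed

text \<open>\<open>log 2 k + 1 \<le> 2 * L\<close> and
  \<open>12 / \<epsilon> + 3 \<le> 15 / \<epsilon>\<close> give \<open>N \<le> 30 * (R * L)\<close>,
  and \<open>k \<le> R * L\<close> gives \<open>2 * N + k \<le> 61 * (R * L)\<close>. With the
  leading 1 absorbed, the constant is \<open>30 * 61 + 1 = 1831\<close>.\<close>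

lemma log_size_bound:
  fixes k :: nat and \<epsilon> :: real
  assumes k: "1 \<le> k" and eps: "0 < \<epsilon>" "\<epsilon> < 1"
    and N: "real N \<le> real k * (log 2 (real k) + 1) * (12 / \<epsilon> + 3)"
  shows "1 + real (N * (2 * N + k)) \<le> 1831 * (real k / \<epsilon>)\<^sup>2 * (log 2 (2 + real k / \<epsilon>)) ^ 2"
proof -
  define R where "R = real k / \<epsilon>"
  define L where "L = log 2 (2 + R)"
  have kR: "real k \<le> R" unfolding R_def using eps by (simp add: field_simps mult_left_le_one_le)
  then have R1: "1 \<le> R" using k by linarith
  have L1: "1 \<le> L" unfolding L_def using R1 by (simp add: le_log_iff)
  have "log 2 (real k) \<le> L" unfolding L_def using k kR by (intro log_mono) auto
  then have "log 2 (real k) + 1 \<le> 2 * L" using L1 by linarith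
  moreover have "12 / \<epsilon> + 3 \<le> 15 / \<epsilon>" using eps by (simp add: field_simps)
  ultimately have "real k * (log 2 (real k) + 1) * (12 / \<epsilon> + 3) \<le> real k * (2 * L) * (15 / \<epsilon>)"
    using eps k L1 by (intro mult_mono mult_left_mono mult_nonneg_nonneg) auto
  also have "\<dots> = 30 * (R * L)" unfolding R_def by simp
  finally have N: "real N \<le> 30 * (R * L)" using N by linarith
  have RL: "1 \<le> R * L" using mult_mono[OF R1 L1] R1 by simp
  have "R * 1 \<le> R * L" using R1 by (intro mult_left_mono[OF L1]) simp
  then have "real k \<le> R * L" using kR by linarith
  then have "2 * real N + real k \<le> 61 * (R * L)" using N by linarith
  then have "real N * (2 * real N + real k) \<le> 30 * (R * L) * (61 * (R * L))"
    using N RL by (intro mult_mono) auto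
  moreover have "1 \<le> (R * L) * (R * L)" using mult_mono[OF RL RL] RL by simp
  ultimately have "1 + real N * (2 * real N + real k) \<le> 1831 * ((R * L) * (R * L))" by linarith
  then show ?thesis unfolding R_def[symmetric] L_def[symmetric] by (simp add: power2_eq_square algebra_simps)
qed

theorem theoremG9:
  "\<exists>(C::real) (a::nat). \<forall>(\<epsilon>::real) V E T c \<sigma>.
     0 < \<epsilon> \<and> \<epsilon> < 1 \<and> is_network V E T c \<and> planar_embedding V E \<sigma> \<and> gamma_one V E \<sigma> T \<longrightarrow>
     (\<exists>VH EH cH.
        is_network VH EH T cH \<and> is_terminal_minor VH EH V E T \<and>
        real (card VH) \<le> C * (real (card T) / \<epsilon>)\<^sup>2 * (log 2 (2 + real (card T) / \<epsilon>)) ^ a \<and>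
        (\<forall>S. S \<subseteq> T \<and> S \<noteq> {} \<and> S \<noteq> T \<longrightarrow>
           mincut V E T c S \<le> mincut VH EH T cH S \<and>
           mincut VH EH T cH S \<le> (1 + \<epsilon>) * mincut V E T c S))"
proof (rule exI[of _ 1831], rule exI[of _ 2], intro allI impI, elim conjE)
  fix \<epsilon> :: real and V E T c \<sigma>
  assume eps: "0 < \<epsilon>" "\<epsilon> < 1" and net: "is_network V E T c"
    and emb: "planar_embedding V E \<sigma>" and gam: "gamma_one V E \<sigma> T"
  interpret network V E T c by (rule network.intro[OF net])
  have finT: "finite T" using T_subset_V finite_V finite_subset by blast
  have Tne: "T \<noteq> {}" using gam unfolding gamma_one_def by blast
  then have cT: "1 \<le> card T" using finT by (simp add: Suc_le_eq card_gt_0_iff)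
  show "\<exists>VH EH cH.
        is_network VH EH T cH \<and> is_terminal_minor VH EH V E T \<and>
        real (card VH) \<le> 1831 * (real (card T) / \<epsilon>)\<^sup>2 * (log 2 (2 + real (card T) / \<epsilon>)) ^ 2 \<and>
        (\<forall>S. S \<subseteq> T \<and> S \<noteq> {} \<and> S \<noteq> T \<longrightarrow>
           mincut V E T c S \<le> mincut VH EH T cH S \<and>
           mincut VH EH T cH S \<le> (1 + \<epsilon>) * mincut V E T c S)"
  proof (cases "card T = 1")
    case True
    \<comment> \<open>A single terminal has no proper nonempty \<open>S\<close>, so one vertex
      suffices; the split of the terminal face starts at two terminals.\<close>
    then obtain t where t: "T = {t}" using card_1_singletonE by blast
    have "is_network {t} {} T (\<lambda>_. 1)" unfolding is_network_def t by simp
    moreover have "is_terminal_minor {t} {} V E T"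
      unfolding is_terminal_minor_def t using T_subset_V t by (intro exI[of _ "\<lambda>_. {t}"]) simp
    \<comment> \<open>With \<open>N = 0\<close> the size estimate says that the required bound is at
      least 1.\<close>
    moreover have "0 \<le> real (card T) * (log 2 (real (card T)) + 1) * (12 / \<epsilon> + 3)" using eps True by simp
    then have "real (card {t}) \<le> 1831 * (real (card T) / \<epsilon>)\<^sup>2 * (log 2 (2 + real (card T) / \<epsilon>)) ^ 2"
      using log_size_bound[OF cT eps, of 0] by simp
    moreover have "S = {} \<or> S = T" if "S \<subseteq> T" for S using that t by blast
    ultimately show ?thesis by blast
  next
    case False
    then have T2: "2 \<le> card T" using cT by linarith
    then obtain s t where st: "s \<in> T" "t \<in> T" "s \<noteq> t" using card_le_Suc0_iff_eq[OF finT] by force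
    \<comment> \<open>Two terminals in a connected graph force an edge, which rules out the edgeless
      alternatives in the definitions.\<close>
    have "E \<noteq> {}"
    proof
      assume "E = {}"
      then show False using connected_V[of s t] st T_subset_V by auto
    qed
    then have rot: "rotation_system V E \<sigma>"
      and euler: "int (card V) - int (card E) + int (card (faces E \<sigma>)) = 2"
      and ex: "\<exists>f\<in>faces E \<sigma>. T \<subseteq> face_vertices f"
      using emb gam unfolding planar_embedding_def gamma_one_def by auto
    interpret embedded_network V E T c \<sigma> by unfold_locales (rule rot)
    obtain f where f: "f \<in> faces E \<sigma>" "T \<subseteq> face_vertices f" using ex by blast
    obtain d0 nn where pos: "d0 \<in> darts E" "nn 0 = 0" "nn (card T) = period d0"
      "\<And>i. i < card T \<Longrightarrow> nn i < nn (Suc i)" "bij_betw (\<lambda>i. fst ((fp ^^ nn i) d0)) {..<card T} T"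
      using terminal_positions[OF f T2] by blast
    interpret disc_network V E T c \<sigma> d0 nn "card T"
      by unfold_locales (use pos T2 euler in blast)+
    obtain F N where F: "F \<subseteq> E"
      and approx: "\<forall>W\<subseteq>V. \<exists>W'\<subseteq>V. (W' \<inter> T = W \<inter> T \<or> W' \<inter> T = T - W) \<and> cutset E W' \<subseteq> F \<and>
        cut_weight E c W' \<le> (1 + \<epsilon>) * cut_weight E c W"
      and N: "real N \<le> real (card T) * (log 2 (real (card T)) + 1) * (12 / \<epsilon> + 3)"
      and count: "card {D. D \<subseteq> F \<and> (\<exists>W\<subseteq>V. D = cutset E W)} \<le> 2 ^ (N * (2 * N + card T))"
      using approximating_edge_set[OF eps] by (elim exE conjE) (rule that)
    obtain VH EH cH where H: "is_network VH EH T cH" "is_terminal_minor VH EH V E T"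
      and size: "2 ^ (card VH - 1) \<le> card {D. D \<subseteq> F \<and> (\<exists>W\<subseteq>V. D = cutset E W)}"
      and quality: "\<forall>S\<subseteq>T. mincut V E T c S \<le> mincut VH EH T cH S \<and> mincut VH EH T cH S \<le> (1 + \<epsilon>) * mincut V E T c S"
      using sparsifier_from_cut_family[OF F approx] by (elim exE conjE) (rule that)
    have "(2::nat) ^ (card VH - 1) \<le> 2 ^ (N * (2 * N + card T))" using size count by (rule order_trans)
    then have "card VH - 1 \<le> N * (2 * N + card T)" by simp
    then have "real (card VH) \<le> 1 + real (N * (2 * N + card T))" by linarith
    also have "\<dots> \<le> 1831 * (real (card T) / \<epsilon>)\<^sup>2 * (log 2 (2 + real (card T) / \<epsilon>)) ^ 2"
      by (rule log_size_bound[OF cT eps N])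
    finally show ?thesis using H quality by (intro exI[of _ VH] exI[of _ EH] exI[of _ cH]) simp
  qed
qed

end
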